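(* Let $\{\pi_k\}_{k\ge0}$ and $\{V^{\pi_k}\}_{k\ge0}$ be the policy and value sequences generated by PMD with mirror map $h(p)=\sum_a\psi(p(a))$ and a constant step size $\eta>0$. If $\psi'(0^+)=-\infty$ and $\psi'(1^-)<+\infty$, then the sequence of value errors is summable, namely $\sum_{k=0}^\infty\|V^*-V^{\pi_k}\|_\infty<\infty$. Consequently, the policy sequence converges to an optimal policy $\pi_\infty$, i.e. $\lim_{k\to\infty}\pi_k=\pi_\infty\in\Pi^*$. Moreover, $\pi_\infty$ satisfies: (i) $\pi_\infty(a'|s)=0$ for all $s\in\mathcal S$ and $a'\notin\mathcal A_s^*$; (ii) $\pi_\infty(a^*|s)=1$ for all $s\in\mathcal S_{=1}$ and $a^*\in\mathcal A_s^*$; (iii) $\pi_\infty(a^*|s)\in\mathrm{int}\,\mathrm{dom}\,\psi$ for all $s\in\mathcal S_{>1}$ and $a^*\in\mathcal A_s^*$.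
   Context: MDP: $(\mathcal S,\mathcal A,P,r,\gamma)$ is a finite discounted Markov decision process: finite state space $\mathcal S$, finite action space $\mathcal A$, transition model $P(\cdot|s,a)\in\Delta(\mathcal S)$, reward $r:\mathcal S\times\mathcal A\to[0,1]$, discount $\gamma\in[0,1)$. $\Delta(\mathcal X)$ is the probability simplex over a finite set $\mathcal X$. A policy $\pi$ assigns to each $s$ a distribution $\pi(\cdot|s)\in\Delta(\mathcal A)$; $\Pi$ is the set of all policies. $V^\pi(s)$ is the expected value of $\sum_{t\ge0}\gamma^t r(s_t,a_t)$ given $s_0=s$, $a_t\sim\pi(\cdot|s_t)$, $s_{t+1}\sim P(\cdot|s_t,a_t)$, and $Q^\pi(s,a)$ is the same conditioned on $(s_0,a_0)=(s,a)$. $V^*(s)=\max_{\pi\in\Pi}V^\pi(s)$, $Q^*(s,a)=\max_{\pi\in\Pi}Q^\pi(s,a)$; $\Pi^*$ is the set of optimal policies ($V^\pi=V^*$). $\mathcal A^*_s=\{a: Q^*(s,a)=V^*(s)\}$, $\mathcal S_{=1}=\{s:|\mathcal A_s^*|=1\}$, $\mathcal S_{>1}=\{s:|\mathcal A_s^*|>1\}$, $\tilde{\mathcal S}=\{s:\mathcal A_s^*\ne\mathcal A\}$, the last assumed nonempty throughout. Mirror map: $\psi:\mathbb R\to(-\infty,+\infty]$ satisfies: (a) $\mathrm{dom}\,\psi\supseteq[0,1]$; (b) $\psi$ is proper, closed and convex; (c) $\psi$ is differentiable on $\mathrm{int}\,\mathrm{dom}\,\psi$ and $|\psi'(x_n)|\to\infty$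 for every sequence $\{x_n\}\subseteq\mathrm{int}\,\mathrm{dom}\,\psi$ converging to a boundary point of $\mathrm{dom}\,\psi$; (d) $\psi$ is strictly convex on $\mathrm{int}\,\mathrm{dom}\,\psi$. $\psi'(0^+)$ and $\psi'(1^-)$ are the one-sided limits of $\psi'$ at $0$ from the right and at $1$ from the left. $h(p)=\sum_{a\in\mathcal A}\psi(p(a))$ and $D_h(p\|q)=h(p)-h(q)-\langle\nabla h(q),p-q\rangle$. PMD: given $\eta>0$ and an initial policy $\pi_0$ with $\pi_0(a|s)\in\mathrm{int}\,\mathrm{dom}\,\psi$ for all $(s,a)$ (assumed throughout), for each $s$, $\pi_{k+1}(\cdot|s)=\arg\max_{p\in\Delta(\mathcal A)}\{\eta\langle p,Q^{\pi_k}(s,\cdot)\rangle-D_h(p\|\pi_k(\cdot|s))\}$; all iterates satisfy $\pi_k(a|s)\in\mathrm{int}\,\mathrm{dom}\,\psi$. *)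

theory Defs
  imports "HOL-Probability.Probability"
begin

section \<open>Finite discounted Markov decision processes\<close>

text \<open>
  States and actions are finite types, and the simplex over a finite type \<open>'x\<close> is \<open>'x pmf\<close>.
  The data of an MDP are a transition model \<open>P :: 's \<Rightarrow> 'a \<Rightarrow> 's pmf\<close>, a reward
  \<open>r :: 's \<Rightarrow> 'a \<Rightarrow> real\<close> and a discount \<open>\<gamma> :: real\<close>.
\<close>

type_synonym ('s, 'a) policy = "'s \<Rightarrow> 'a pmf"

definition prob_vec :: "'a pmf \<Rightarrow> real ^ 'a::finite" where
  "prob_vec p = (\<chi> a. pmf p a)"

text \<open>
  Law of the \<open>n\<close>-th state-action pair given the earlier ones, when the pair at time \<open>0\<close> has law
  \<open>\<mu>\<close> and the policy \<open>\<pi>\<close> is followed from time \<open>1\<close> on.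
\<close>

definition step_kernel ::
  "('s \<Rightarrow> 'a \<Rightarrow> 's pmf) \<Rightarrow> ('s, 'a) policy \<Rightarrow> ('s \<times> 'a) pmf \<Rightarrow>
    nat \<Rightarrow> (nat \<Rightarrow> 's \<times> 'a) \<Rightarrow> ('s \<times> 'a) measure" where
  "step_kernel P \<pi> \<mu> n \<omega> = measure_pmf
     (case n of 0 \<Rightarrow> \<mu>
      | Suc m \<Rightarrow> bind_pmf (P (fst (\<omega> m)) (snd (\<omega> m))) (\<lambda>s'. map_pmf (Pair s') (\<pi> s')))"

lemma Ionescu_Tulcea_step_kernel:
  fixes P :: "'s::finite \<Rightarrow> 'a::finite \<Rightarrow> 's pmf"
  shows "Ionescu_Tulcea (step_kernel P \<pi> \<mu>) (\<lambda>_. count_space UNIV)"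
proof (rule Ionescu_Tulcea.intro)
  fix n
  show "step_kernel P \<pi> \<mu> n \<in> PiM {0..<n} (\<lambda>_. count_space UNIV) \<rightarrow>\<^sub>M subprob_algebra (count_space UNIV)"
  proof (cases n)
    case 0
    have "measure_pmf \<mu> \<in> space (subprob_algebra (count_space UNIV))"
      by (simp add: space_subprob_algebra prob_space_imp_subprob_space measure_pmf.prob_space_axioms)
    then show ?thesis
      by (simp add: 0 step_kernel_def[abs_def])
  next
    case (Suc m)
    define F where "F = (\<lambda>z :: 's \<times> 'a. measure_pmf
      (bind_pmf (P (fst z) (snd z)) (\<lambda>s'. map_pmf (Pair s') (\<pi> s'))))"
    have "(\<lambda>\<omega>. \<omega> m) \<in> PiM {0..<n} (\<lambda>_. count_space UNIV) \<rightarrow>\<^sub>M (count_space UNIV :: ('s \<times> 'a) measure)"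
      by (rule measurable_component_singleton) (simp add: Suc)
    moreover have "F \<in> count_space UNIV \<rightarrow>\<^sub>M subprob_algebra (count_space UNIV)"
      by (simp add: F_def space_subprob_algebra prob_space_imp_subprob_space
          measure_pmf.prob_space_axioms)
    ultimately have "(\<lambda>\<omega>. F (\<omega> m)) \<in> PiM {0..<n} (\<lambda>_. count_space UNIV) \<rightarrow>\<^sub>M subprob_algebra (count_space UNIV)"
      by (rule measurable_compose)
    then show ?thesis
      by (simp add: Suc step_kernel_def[abs_def] F_def)
  qed
next
  fix n \<omega>
  show "prob_space (step_kernel P \<pi> \<mu> n \<omega>)"
    unfolding step_kernel_def by (rule measure_pmf.prob_space_axioms)
qed

text \<open>The law on infinite trajectories with these conditional laws (Ionescu-Tulcea).\<close>

definition trajectory_law ::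
  "('s \<Rightarrow> 'a \<Rightarrow> 's pmf) \<Rightarrow> ('s, 'a) policy \<Rightarrow> ('s \<times> 'a) pmf \<Rightarrow> (nat \<Rightarrow> 's \<times> 'a) measure" where
  "trajectory_law P \<pi> \<mu> = projective_family.lim UNIV
     (Ionescu_Tulcea.CI (step_kernel P \<pi> \<mu>) (\<lambda>_. count_space UNIV)) (\<lambda>_. count_space UNIV)"

lemma prob_space_trajectory_law:
  fixes P :: "'s::finite \<Rightarrow> 'a::finite \<Rightarrow> 's pmf"
  shows "prob_space (trajectory_law P \<pi> \<mu>)"
proof -
  interpret IT: Ionescu_Tulcea "step_kernel P \<pi> \<mu>" "\<lambda>_. count_space UNIV"
    by (rule Ionescu_Tulcea_step_kernel)
  have eq: "trajectory_law P \<pi> \<mu> = IT.PF.lim"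
    by (simp add: trajectory_law_def)
  have "emeasure IT.PF.lim (IT.PF.emb UNIV {} {\<lambda>_. undefined}) = emeasure (IT.CI {}) {\<lambda>_. undefined}"
    by (rule IT.lim) (auto simp: sets_PiM_empty)
  moreover have "IT.PF.emb UNIV {} {\<lambda>_. undefined} = space IT.PF.lim"
    by (auto simp: prod_emb_def space_PiM)
  moreover have "emeasure (IT.CI {}) {\<lambda>_. undefined} = 1"
    using prob_space.emeasure_space_1[OF IT.PF.prob_space_P[of "{}"]]
    by (simp add: IT.CI_def space_PiM_empty)
  ultimately show ?thesis
    by (auto simp: eq intro: prob_spaceI)
qed

definition expected_return ::
  "('s \<Rightarrow> 'a \<Rightarrow> 's pmf) \<Rightarrow> ('s \<Rightarrow> 'a \<Rightarrow> real) \<Rightarrow> real \<Rightarrow> ('s, 'a) policy \<Rightarrow> ('s \<times> 'a) pmf \<Rightarrow> real" where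
  "expected_return P r \<gamma> \<pi> \<mu> =
     (\<integral>\<omega>. (\<Sum>t. \<gamma> ^ t * r (fst (\<omega> t)) (snd (\<omega> t))) \<partial>trajectory_law P \<pi> \<mu>)"

definition V_pol ::
  "('s \<Rightarrow> 'a \<Rightarrow> 's pmf) \<Rightarrow> ('s \<Rightarrow> 'a \<Rightarrow> real) \<Rightarrow> real \<Rightarrow> ('s, 'a) policy \<Rightarrow> 's \<Rightarrow> real" where
  "V_pol P r \<gamma> \<pi> s = expected_return P r \<gamma> \<pi> (map_pmf (Pair s) (\<pi> s))"

text \<open>
  Conditioning on \<open>(s\<^sub>0, a\<^sub>0) = (s, a)\<close> is rendered by starting the trajectory in \<open>(s, a)\<close>, so that
  \<open>Q_pol\<close> is also defined where \<open>\<pi>\<close> gives \<open>a\<close> probability \<open>0\<close> in \<open>s\<close>.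
\<close>

definition Q_pol ::
  "('s \<Rightarrow> 'a \<Rightarrow> 's pmf) \<Rightarrow> ('s \<Rightarrow> 'a \<Rightarrow> real) \<Rightarrow> real \<Rightarrow> ('s, 'a) policy \<Rightarrow> 's \<Rightarrow> 'a \<Rightarrow> real" where
  "Q_pol P r \<gamma> \<pi> s a = expected_return P r \<gamma> \<pi> (return_pmf (s, a))"

text \<open>
  For rewards in \<open>[0,1]\<close> and \<open>0 \<le> \<gamma> < 1\<close> the following suprema are over bounded sets and are
  the maxima over all policies.
\<close>

definition V_opt ::
  "('s \<Rightarrow> 'a \<Rightarrow> 's pmf) \<Rightarrow> ('s \<Rightarrow> 'a \<Rightarrow> real) \<Rightarrow> real \<Rightarrow> 's \<Rightarrow> real" where
  "V_opt P r \<gamma> s = (SUP \<pi>. V_pol P r \<gamma> \<pi> s)"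

definition Q_opt ::
  "('s \<Rightarrow> 'a \<Rightarrow> 's pmf) \<Rightarrow> ('s \<Rightarrow> 'a \<Rightarrow> real) \<Rightarrow> real \<Rightarrow> 's \<Rightarrow> 'a \<Rightarrow> real" where
  "Q_opt P r \<gamma> s a = (SUP \<pi>. Q_pol P r \<gamma> \<pi> s a)"

definition optimal_policies ::
  "('s \<Rightarrow> 'a \<Rightarrow> 's pmf) \<Rightarrow> ('s \<Rightarrow> 'a \<Rightarrow> real) \<Rightarrow> real \<Rightarrow> ('s, 'a) policy set" where
  "optimal_policies P r \<gamma> = {\<pi>. V_pol P r \<gamma> \<pi> = V_opt P r \<gamma>}"

definition opt_actions ::
  "('s \<Rightarrow> 'a \<Rightarrow> 's pmf) \<Rightarrow> ('s \<Rightarrow> 'a \<Rightarrow> real) \<Rightarrow> real \<Rightarrow> 's \<Rightarrow> 'a set" where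
  "opt_actions P r \<gamma> s = {a. Q_opt P r \<gamma> s a = V_opt P r \<gamma> s}"

definition S_eq1 ::
  "('s \<Rightarrow> 'a \<Rightarrow> 's pmf) \<Rightarrow> ('s \<Rightarrow> 'a \<Rightarrow> real) \<Rightarrow> real \<Rightarrow> 's set" where
  "S_eq1 P r \<gamma> = {s. card (opt_actions P r \<gamma> s) = 1}"

definition S_gt1 ::
  "('s \<Rightarrow> 'a \<Rightarrow> 's pmf) \<Rightarrow> ('s \<Rightarrow> 'a \<Rightarrow> real) \<Rightarrow> real \<Rightarrow> 's set" where
  "S_gt1 P r \<gamma> = {s. card (opt_actions P r \<gamma> s) > 1}"

definition S_tilde ::
  "('s \<Rightarrow> 'a \<Rightarrow> 's pmf) \<Rightarrow> ('s \<Rightarrow> 'a \<Rightarrow> real) \<Rightarrow> real \<Rightarrow> 's set" where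
  "S_tilde P r \<gamma> = {s. opt_actions P r \<gamma> s \<noteq> UNIV}"

definition sup_norm :: "('s::finite \<Rightarrow> real) \<Rightarrow> real" where
  "sup_norm f = (MAX s. \<bar>f s\<bar>)"


section \<open>Mirror maps\<close>

definition dom_fun :: "(real \<Rightarrow> ereal) \<Rightarrow> real set" where
  "dom_fun \<psi> = {x. \<psi> x < \<infinity>}"

definition epi :: "(real \<Rightarrow> ereal) \<Rightarrow> (real \<times> real) set" where
  "epi \<psi> = {(x, t). \<psi> x \<le> ereal t}"

definition proper_fun :: "(real \<Rightarrow> ereal) \<Rightarrow> bool" where
  "proper_fun \<psi> \<longleftrightarrow> dom_fun \<psi> \<noteq> {} \<and> (\<forall>x. \<psi> x \<noteq> -\<infinity>)"

definition strictly_convex_on :: "real set \<Rightarrow> (real \<Rightarrow> real) \<Rightarrow> bool" where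
  "strictly_convex_on S f \<longleftrightarrow> convex S \<and>
     (\<forall>x\<in>S. \<forall>y\<in>S. \<forall>t. x \<noteq> y \<longrightarrow> 0 < t \<longrightarrow> t < 1 \<longrightarrow>
        f ((1 - t) * x + t * y) < (1 - t) * f x + t * f y)"

definition fin_part :: "('b \<Rightarrow> ereal) \<Rightarrow> 'b \<Rightarrow> real" where
  "fin_part f x = real_of_ereal (f x)"

text \<open>Meaningful on the interior of the domain, where \<open>fin_part \<psi>\<close> agrees with \<open>\<psi>\<close>.\<close>

definition dpsi :: "(real \<Rightarrow> ereal) \<Rightarrow> real \<Rightarrow> real" where
  "dpsi \<psi> = deriv (fin_part \<psi>)"

definition mirror_map :: "(real \<Rightarrow> ereal) \<Rightarrow> bool" where
  "mirror_map \<psi> \<longleftrightarrow>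
     {0..1} \<subseteq> dom_fun \<psi> \<and>
     proper_fun \<psi> \<and> closed (epi \<psi>) \<and> convex (epi \<psi>) \<and>
     (\<forall>x\<in>interior (dom_fun \<psi>). fin_part \<psi> differentiable (at x)) \<and>
     (\<forall>X x. (\<forall>n. X n \<in> interior (dom_fun \<psi>)) \<longrightarrow> X \<longlonglongrightarrow> x \<longrightarrow> x \<in> frontier (dom_fun \<psi>) \<longrightarrow>
        filterlim (\<lambda>n. \<bar>dpsi \<psi> (X n)\<bar>) at_top sequentially) \<and>
     strictly_convex_on (interior (dom_fun \<psi>)) (fin_part \<psi>)"

definition h_map :: "(real \<Rightarrow> ereal) \<Rightarrow> real ^ 'a::finite \<Rightarrow> ereal" where
  "h_map \<psi> p = (\<Sum>a\<in>UNIV. \<psi> (p $ a))"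

definition gradient :: "('b::real_inner \<Rightarrow> real) \<Rightarrow> 'b \<Rightarrow> 'b" where
  "gradient f x = (THE D. GDERIV f x :> D)"

definition bregman :: "(real ^ 'a::finite \<Rightarrow> ereal) \<Rightarrow> real ^ 'a \<Rightarrow> real ^ 'a \<Rightarrow> ereal" where
  "bregman h p q = h p - h q - ereal (gradient (fin_part h) q \<bullet> (p - q))"


section \<open>Policy mirror descent\<close>

definition pmd_sequence ::
  "('s::finite \<Rightarrow> 'a::finite \<Rightarrow> 's pmf) \<Rightarrow> ('s \<Rightarrow> 'a \<Rightarrow> real) \<Rightarrow> real \<Rightarrow> (real \<Rightarrow> ereal) \<Rightarrow> real \<Rightarrow>
    (nat \<Rightarrow> ('s, 'a) policy) \<Rightarrow> bool" where
  "pmd_sequence P r \<gamma> \<psi> \<eta> \<pi> \<longleftrightarrow>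
     (\<forall>s a. pmf (\<pi> 0 s) a \<in> interior (dom_fun \<psi>)) \<and>
     (\<forall>k s. is_arg_max
        (\<lambda>p. ereal (\<eta> * (prob_vec p \<bullet> (\<chi> a. Q_pol P r \<gamma> (\<pi> k) s a)))
              - bregman (h_map \<psi>) (prob_vec p) (prob_vec (\<pi> k s)))
        (\<lambda>p. p \<in> UNIV) (\<pi> (Suc k) s))"

end

theory Submission
  imports Defs
begin

text \<open>
  Write \<open>\<phi>\<close> for the derivative of the mirror map. Its two limits place \<open>0\<close> on the boundary of the
  domain, with \<open>\<phi>\<close> unbounded below there, and \<open>1\<close> in the interior
  (\<open>steep_potential_mirror_map\<close>). Hence each update has all its probabilities positive
  (\<open>minimizer_pos\<close>) and is characterized by a Lagrange condition (\<open>minimizer_stationary\<close>): up to a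
  shift common to all actions, \<open>\<phi>\<close> of the new probabilities is \<open>\<phi>\<close> of the old ones plus \<open>\<eta>\<close> times
  the \<open>Q\<close>-values.

  This condition yields the three-point identity for Bregman divergences. Compared with the old
  iterate it shows that values increase along the sequence; compared with an optimal policy it
  bounds the one-step advantage of that policy by a telescoping difference of divergences plus a
  telescoping difference of values. The divergence from the optimal policy to the initial one is
  finite because the mirror map is finite at \<open>0\<close>, so the accumulated advantages, and through the
  Bellman recursion the accumulated value errors, stay bounded (\<open>summable_value_error\<close>).

  Summability pays off in the dual coordinates, where the difference of the \<open>\<phi>\<close>-values of two
  actions after \<open>k\<close> steps is its initial value plus \<open>\<eta>\<close> times the sum of the differences of their
  \<open>Q\<close>-values. For two optimal actions this sum converges; for a nonoptimal against an optimal one it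
  tends to \<open>-\<infinity>\<close>, and since \<open>\<phi>\<close> is bounded above by \<open>\<phi> 1\<close> the nonoptimal action loses all its mass.
  Limits of all potential differences among the optimal actions, together with total mass \<open>1\<close>,
  determine the limit policy and force it to be positive on every optimal action
  (\<open>simplex_sequence_converges\<close>). A policy supported on optimal actions is optimal.

  On the side of the decision process, the trajectory definition of values is reduced to the Bellman
  equations through the marginal laws of the trajectory
  (\<open>nn_integral_trajectory_law_component\<close>), and one policy attaining all optimal values at once is
  found among the deterministic ones (\<open>ex_greedy_for_itself\<close>).
\<close>

section \<open>Bellman equations from trajectories\<close>

definition succ_law ::
  "('s \<Rightarrow> 'a \<Rightarrow> 's pmf) \<Rightarrow> ('s, 'a) policy \<Rightarrow> 's \<times> 'a \<Rightarrow> ('s \<times> 'a) pmf" where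
  "succ_law P \<pi> z = bind_pmf (P (fst z) (snd z)) (\<lambda>s'. map_pmf (Pair s') (\<pi> s'))"

primrec time_law ::
  "('s \<Rightarrow> 'a \<Rightarrow> 's pmf) \<Rightarrow> ('s, 'a) policy \<Rightarrow> ('s \<times> 'a) pmf \<Rightarrow> nat \<Rightarrow> ('s \<times> 'a) pmf" where
  "time_law P \<pi> \<mu> 0 = \<mu>"
| "time_law P \<pi> \<mu> (Suc n) = bind_pmf (time_law P \<pi> \<mu> n) (succ_law P \<pi>)"

text \<open>
  Mixing the initial laws mixes the laws at every later time; this makes the expected return
  affine in the initial law.
\<close>

lemma time_law_bind: "time_law P \<pi> (bind_pmf \<mu> f) n = bind_pmf \<mu> (\<lambda>x. time_law P \<pi> (f x) n)"
  by (induction n) (simp_all add: bind_assoc_pmf)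

text \<open>
  The Markov property at time \<open>1\<close>, from which the Bellman equation follows.
\<close>

lemma time_law_Suc_shift: "time_law P \<pi> \<mu> (Suc n) = time_law P \<pi> (bind_pmf \<mu> (succ_law P \<pi>)) n"
  by (induction n) simp_all

lemma sets_trajectory_law:
  fixes P :: "'s::finite \<Rightarrow> 'a::finite \<Rightarrow> 's pmf"
  shows "sets (trajectory_law P \<pi> \<mu>) = sets (PiM UNIV (\<lambda>_. count_space UNIV))"
proof -
  interpret IT: Ionescu_Tulcea "step_kernel P \<pi> \<mu>" "\<lambda>_. count_space UNIV"
    by (rule Ionescu_Tulcea_step_kernel)
  show ?thesis
    by (simp add: trajectory_law_def IT.PF.sets_lim)
qed

text \<open>
  The step at time \<open>n\<close> of the Ionescu-Tulcea construction depends on the past only through the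
  last pair, so integrating out one coordinate at a time turns the construction into the iterated
  kernel. Only this one-dimensional marginal matters later, because the return is additive in time.
\<close>

lemma nn_integral_trajectory_law_component:
  fixes P :: "'s::finite \<Rightarrow> 'a::finite \<Rightarrow> 's pmf" and g :: "'s \<times> 'a \<Rightarrow> ennreal"
  shows "(\<integral>\<^sup>+\<omega>. g (\<omega> n) \<partial>trajectory_law P \<pi> \<mu>) = (\<integral>\<^sup>+z. g z \<partial>time_law P \<pi> \<mu> n)"
proof -
  interpret IT: Ionescu_Tulcea "step_kernel P \<pi> \<mu>" "\<lambda>_. count_space UNIV"
    by (rule Ionescu_Tulcea_step_kernel)
  let ?u = "\<lambda>_::nat. undefined :: 's \<times> 'a"
  have u: "?u \<in> space (PiM {0..<0} (\<lambda>_. count_space UNIV))"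
    by (simp add: space_PiM)
  have comp[measurable]: "(\<lambda>\<omega>. g (\<omega> n)) \<in> borel_measurable (PiM {0..<Suc n} (\<lambda>_. count_space UNIV))"
    for g :: "'s \<times> 'a \<Rightarrow> ennreal" and n :: nat
    by (rule measurable_compose[OF measurable_component_singleton]) auto
  \<comment> \<open>\<open>IT.C 0 n\<close> is the joint law of the first \<open>n\<close> pairs; \<open>?u\<close> is the empty history.\<close>
  have step: "(\<integral>\<^sup>+\<omega>. g (\<omega> n) \<partial>IT.C 0 (Suc n) ?u) =
      (\<integral>\<^sup>+\<omega>. \<integral>\<^sup>+z. g z \<partial>step_kernel P \<pi> \<mu> n \<omega> \<partial>IT.C 0 n ?u)" for n and g :: "'s \<times> 'a \<Rightarrow> ennreal"
  proof -
    have "(\<integral>\<^sup>+\<omega>. g (\<omega> n) \<partial>IT.C 0 (Suc n) ?u) =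
        (\<integral>\<^sup>+\<omega>. \<integral>\<^sup>+\<omega>'. g (\<omega>' n) \<partial>IT.eP n \<omega> \<partial>IT.C 0 n ?u)"
      using IT.measurable_eP[of n]
      by (simp add: nn_integral_bind[where B="PiM {0..<Suc n} (\<lambda>_. count_space UNIV)"]
          measurable_cong_sets[OF IT.sets_C[OF u] refl] del: atLeastLessThan_iff)
    also have "\<dots> = (\<integral>\<^sup>+\<omega>. \<integral>\<^sup>+z. g z \<partial>step_kernel P \<pi> \<mu> n \<omega> \<partial>IT.C 0 n ?u)"
      by (rule nn_integral_cong) (use u in \<open>simp add: IT.space_C IT.nn_integral_eP\<close>)
    finally show ?thesis .
  qed
  have C: "(\<integral>\<^sup>+\<omega>. g (\<omega> n) \<partial>IT.C 0 (Suc n) ?u) = (\<integral>\<^sup>+z. g z \<partial>time_law P \<pi> \<mu> n)"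
    for n and g :: "'s \<times> 'a \<Rightarrow> ennreal"
  proof (induction n arbitrary: g)
    case 0
    interpret p: prob_space "IT.C 0 0 ?u" by (rule IT.prob_space_C[OF u])
    show ?case
      by (subst step) (simp only: step_kernel_def nat.case nn_integral_const p.emeasure_space_1,
          simp)
  next
    case (Suc n)
    have "(\<integral>\<^sup>+\<omega>. g (\<omega> (Suc n)) \<partial>IT.C 0 (Suc (Suc n)) ?u) =
        (\<integral>\<^sup>+\<omega>. \<integral>\<^sup>+z. g z \<partial>succ_law P \<pi> (\<omega> n) \<partial>IT.C 0 (Suc n) ?u)"
      by (subst step) (simp only: step_kernel_def nat.case succ_law_def)
    also have "\<dots> = (\<integral>\<^sup>+z. \<integral>\<^sup>+z'. g z' \<partial>succ_law P \<pi> z \<partial>time_law P \<pi> \<mu> n)"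
      by (rule Suc)
    finally show ?case
      by (simp only: time_law.simps nn_integral_bind_pmf)
  qed
  let ?J = "{0..<Suc n}"
  have up: "IT.up_to ?J = Suc n"
    by (rule antisym) (simp_all add: IT.up_to_iff Suc_le_eq IT.up_to_less)
  have R: "(\<lambda>f. restrict f ?J) \<in> PiM I (\<lambda>_. count_space UNIV) \<rightarrow>\<^sub>M PiM ?J (\<lambda>_. count_space UNIV)"
    if "?J \<subseteq> I" for I :: "nat set"
    using that by (intro measurable_restrict measurable_component_singleton) auto
  have "(\<integral>\<^sup>+\<omega>. g (\<omega> n) \<partial>trajectory_law P \<pi> \<mu>) = (\<integral>\<^sup>+\<omega>. g (restrict \<omega> ?J n) \<partial>IT.PF.lim)"
    by (simp add: trajectory_law_def)
  also have "\<dots> = (\<integral>\<^sup>+\<omega>. g (\<omega> n) \<partial>distr IT.PF.lim (PiM ?J (\<lambda>_. count_space UNIV)) (\<lambda>f. restrict f ?J))"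
    by (subst nn_integral_distr)
      (auto intro: R comp simp: measurable_cong_sets[OF IT.PF.sets_lim refl] simp del: restrict_apply)
  also have "\<dots> = (\<integral>\<^sup>+\<omega>. g (\<omega> n) \<partial>distr (IT.C 0 (Suc n) ?u) (PiM ?J (\<lambda>_. count_space UNIV)) (\<lambda>f. restrict f ?J))"
    by (subst IT.distr_lim) (simp_all only: finite_atLeastLessThan IT.CI_def up)
  also have "\<dots> = (\<integral>\<^sup>+\<omega>. g (restrict \<omega> ?J n) \<partial>IT.C 0 (Suc n) ?u)"
  proof (subst nn_integral_distr)
    have "sets (IT.C 0 (Suc n) ?u) = sets (PiM ?J (\<lambda>_. count_space UNIV))"
      using IT.sets_C[OF u, of "Suc n"] by simp
    then show "(\<lambda>f. restrict f ?J) \<in> IT.C 0 (Suc n) ?u \<rightarrow>\<^sub>M PiM ?J (\<lambda>_. count_space UNIV)"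
      using R[of ?J] by (subst measurable_cong_sets[OF _ refl]) auto
  qed (simp_all add: comp)
  also have "\<dots> = (\<integral>\<^sup>+\<omega>. g (\<omega> n) \<partial>IT.C 0 (Suc n) ?u)"
    by simp
  finally show ?thesis by (simp only: C)
qed

lemma integral_trajectory_law_component:
  fixes P :: "'s::finite \<Rightarrow> 'a::finite \<Rightarrow> 's pmf" and g :: "'s \<times> 'a \<Rightarrow> real"
  shows "(\<integral>\<omega>. g (\<omega> n) \<partial>trajectory_law P \<pi> \<mu>) = measure_pmf.expectation (time_law P \<pi> \<mu> n) g"
proof -
  have m: "(\<lambda>\<omega>. \<omega> n) \<in> trajectory_law P \<pi> \<mu> \<rightarrow>\<^sub>M count_space UNIV"
    by (subst measurable_cong_sets[OF sets_trajectory_law refl])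
      (auto intro: measurable_component_singleton)
  have "distr (trajectory_law P \<pi> \<mu>) (count_space UNIV) (\<lambda>\<omega>. \<omega> n) = time_law P \<pi> \<mu> n"
  proof (rule measure_eqI)
    fix A
    show "emeasure (distr (trajectory_law P \<pi> \<mu>) (count_space UNIV) (\<lambda>\<omega>. \<omega> n)) A = emeasure (time_law P \<pi> \<mu> n) A"
      using nn_integral_trajectory_law_component[where g="indicator A" and P=P and \<pi>=\<pi> and \<mu>=\<mu> and n=n]
      by (simp add: nn_integral_distr[OF m] flip: nn_integral_indicator)
  qed simp
  then show ?thesis
    using integral_distr[OF m, of g] by simp
qed

text \<open>
  The terms are dominated by \<open>\<gamma> ^ n\<close>, so expectation and series may be exchanged.
\<close>

lemma expected_return_eq_series:
  fixes P :: "'s::finite \<Rightarrow> 'a::finite \<Rightarrow> 's pmf"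
  assumes r: "\<And>s a. r s a \<in> {0..1}" and g: "0 \<le> \<gamma>" "\<gamma> < 1"
  shows "(\<lambda>n. \<gamma> ^ n * measure_pmf.expectation (time_law P \<pi> \<mu> n) (\<lambda>z. r (fst z) (snd z)))
    sums expected_return P r \<gamma> \<pi> \<mu>"
proof -
  interpret prob_space "trajectory_law P \<pi> \<mu>" by (rule prob_space_trajectory_law)
  let ?f = "\<lambda>n \<omega>. \<gamma> ^ n * r (fst (\<omega> n)) (snd (\<omega> n))"
  have b: "\<bar>?f n \<omega>\<bar> \<le> \<gamma> ^ n" for n \<omega>
    using r[of "fst (\<omega> n)" "snd (\<omega> n)"] g by (simp add: abs_mult mult_left_le)
  have m: "?f n \<in> borel_measurable (trajectory_law P \<pi> \<mu>)" for n
  proof -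
    have "(\<lambda>\<omega>. \<omega> n) \<in> trajectory_law P \<pi> \<mu> \<rightarrow>\<^sub>M count_space UNIV"
      by (subst measurable_cong_sets[OF sets_trajectory_law refl])
        (auto intro: measurable_component_singleton)
    from measurable_compose[OF this, of "\<lambda>z. \<gamma> ^ n * r (fst z) (snd z)" borel] show ?thesis by simp
  qed
  have i: "integrable (trajectory_law P \<pi> \<mu>) (?f n)" for n
    by (rule integrable_const_bound[OF _ m, where B="\<gamma> ^ n"]) (use b in auto)
  have s: "summable (\<lambda>n. \<gamma> ^ n)" using g by (simp add: summable_geometric)
  have "(\<lambda>n. \<integral>\<omega>. ?f n \<omega> \<partial>trajectory_law P \<pi> \<mu>) sums (\<integral>\<omega>. (\<Sum>n. ?f n \<omega>) \<partial>trajectory_law P \<pi> \<mu>)"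
  proof (rule sums_integral[OF i])
    show "AE \<omega> in trajectory_law P \<pi> \<mu>. summable (\<lambda>n. norm (?f n \<omega>))"
      using b by (intro AE_I2 summable_comparison_test'[OF s]) simp
    have "norm (\<integral>\<omega>. norm (?f n \<omega>) \<partial>trajectory_law P \<pi> \<mu>) \<le> \<gamma> ^ n" for n
    proof -
      have "(\<integral>\<omega>. norm (?f n \<omega>) \<partial>trajectory_law P \<pi> \<mu>) \<le> (\<integral>\<omega>. \<gamma> ^ n \<partial>trajectory_law P \<pi> \<mu>)"
        using b i by (intro integral_mono) auto
      then show ?thesis by (simp add: prob_space)
    qed
    then show "summable (\<lambda>n. \<integral>\<omega>. norm (?f n \<omega>) \<partial>trajectory_law P \<pi> \<mu>)"
      by (intro summable_comparison_test'[OF s])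
  qed
  moreover have "(\<integral>\<omega>. ?f n \<omega> \<partial>trajectory_law P \<pi> \<mu>) =
      \<gamma> ^ n * measure_pmf.expectation (time_law P \<pi> \<mu> n) (\<lambda>z. r (fst z) (snd z))" for n
    using integral_trajectory_law_component[where g="\<lambda>z. \<gamma> ^ n * r (fst z) (snd z)" and n=n] by simp
  ultimately show ?thesis by (simp only: expected_return_def)
qed

lemma expected_return_linear:
  fixes P :: "'s::finite \<Rightarrow> 'a::finite \<Rightarrow> 's pmf"
  assumes r: "\<And>s a. r s a \<in> {0..1}" and g: "0 \<le> \<gamma>" "\<gamma> < 1"
  shows "expected_return P r \<gamma> \<pi> \<mu> = (\<Sum>z\<in>UNIV. pmf \<mu> z * Q_pol P r \<gamma> \<pi> (fst z) (snd z))"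
proof -
  have mix: "time_law P \<pi> \<mu> n = bind_pmf \<mu> (\<lambda>z. time_law P \<pi> (return_pmf z) n)" for n
    by (metis bind_return_pmf' time_law_bind)
  have "measure_pmf.expectation (time_law P \<pi> \<mu> n) h =
      (\<Sum>z\<in>UNIV. pmf \<mu> z * measure_pmf.expectation (time_law P \<pi> (return_pmf z) n) h)"
    for n and h :: "'s \<times> 'a \<Rightarrow> real"
    by (subst mix) (simp add: pmf_expectation_bind[of UNIV])
  moreover have "(\<lambda>n. \<Sum>z\<in>UNIV. pmf \<mu> z *
      (\<gamma> ^ n * measure_pmf.expectation (time_law P \<pi> (return_pmf z) n) (\<lambda>z. r (fst z) (snd z))))
    sums (\<Sum>z\<in>UNIV. pmf \<mu> z * Q_pol P r \<gamma> \<pi> (fst z) (snd z))"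
    unfolding Q_pol_def prod.collapse
    by (intro sums_sum sums_mult expected_return_eq_series r g)
  ultimately show ?thesis
    using expected_return_eq_series[where r=r and \<mu>=\<mu> and P=P and \<pi>=\<pi>, OF r g]
    by (intro sums_unique2) (auto simp: sum_distrib_left mult_ac)
qed

lemma sum_pmf_map_Pair:
  fixes s :: "'s::finite" and p :: "'a::finite pmf" and h :: "'s \<times> 'a \<Rightarrow> real"
  shows "(\<Sum>z\<in>UNIV. pmf (map_pmf (Pair s) p) z * h z) = (\<Sum>a\<in>UNIV. pmf p a * h (s, a))"
proof -
  have "(\<Sum>z\<in>UNIV. pmf (map_pmf (Pair s) p) z * h z) = measure_pmf.expectation (map_pmf (Pair s) p) h"
    by (subst integral_measure_pmf_real[of UNIV]) (simp_all add: mult.commute)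
  also have "\<dots> = measure_pmf.expectation p (\<lambda>a. h (s, a))"
    by simp
  also have "\<dots> = (\<Sum>a\<in>UNIV. pmf p a * h (s, a))"
    by (subst integral_measure_pmf_real[of UNIV]) (simp_all add: mult.commute)
  finally show ?thesis .
qed

lemma V_pol_eq:
  fixes P :: "'s::finite \<Rightarrow> 'a::finite \<Rightarrow> 's pmf"
  assumes r: "\<And>s a. r s a \<in> {0..1}" and g: "0 \<le> \<gamma>" "\<gamma> < 1"
  shows "V_pol P r \<gamma> \<pi> s = (\<Sum>a\<in>UNIV. pmf (\<pi> s) a * Q_pol P r \<gamma> \<pi> s a)"
  unfolding V_pol_def expected_return_linear[where r=r, OF r g] sum_pmf_map_Pair by simp

lemma Q_pol_eq:
  fixes P :: "'s::finite \<Rightarrow> 'a::finite \<Rightarrow> 's pmf"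
  assumes r: "\<And>s a. r s a \<in> {0..1}" and g: "0 \<le> \<gamma>" "\<gamma> < 1"
  shows "Q_pol P r \<gamma> \<pi> s a = r s a + \<gamma> * (\<Sum>s'\<in>UNIV. pmf (P s a) s' * V_pol P r \<gamma> \<pi> s')"
proof -
  let ?e = "\<lambda>\<mu> n. measure_pmf.expectation (time_law P \<pi> \<mu> n) (\<lambda>z. r (fst z) (snd z))"
  let ?\<mu> = "succ_law P \<pi> (s, a)"
  have shift: "?e (return_pmf (s, a)) (Suc n) = ?e ?\<mu> n" for n
    by (simp only: time_law_Suc_shift bind_return_pmf)
  have "(\<lambda>n. \<gamma> ^ Suc n * ?e (return_pmf (s, a)) (Suc n)) sums (\<gamma> * expected_return P r \<gamma> \<pi> ?\<mu>)"
    using sums_mult[OF expected_return_eq_series[where r=r and P=P and \<pi>=\<pi> and \<mu>="?\<mu>", OF r g], of \<gamma>]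
    by (simp only: shift power_Suc mult.assoc)
  from sums_Suc[OF this]
  have "(\<lambda>n. \<gamma> ^ n * ?e (return_pmf (s, a)) n) sums (r s a + \<gamma> * expected_return P r \<gamma> \<pi> ?\<mu>)"
    by (simp add: add.commute)
  then have "Q_pol P r \<gamma> \<pi> s a = r s a + \<gamma> * expected_return P r \<gamma> \<pi> ?\<mu>"
    unfolding Q_pol_def using expected_return_eq_series[where r=r, OF r g] by (rule sums_unique2[rotated])
  also have "expected_return P r \<gamma> \<pi> ?\<mu> = measure_pmf.expectation ?\<mu> (\<lambda>z. Q_pol P r \<gamma> \<pi> (fst z) (snd z))"
    by (simp add: expected_return_linear[where r=r, OF r g] integral_measure_pmf_real[of UNIV] mult_ac)
  also have "\<dots> = (\<Sum>s'\<in>UNIV. pmf (P s a) s' * V_pol P r \<gamma> \<pi> s')"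
    unfolding succ_law_def V_pol_eq[where r=r, OF r g]
    by (subst pmf_expectation_bind[of UNIV])
      (simp_all add: integral_measure_pmf_real[of UNIV] mult.commute)
  finally show ?thesis .
qed

section \<open>Optimal policies of finite decision processes\<close>

lemma ex_max_finite_type: "\<exists>x. \<forall>y. f y \<le> (f x :: real)" for f :: "'x::finite \<Rightarrow> real"
proof -
  have "Max (range f) \<in> range f" by (rule Max_in) auto
  then obtain x where "f x = Max (range f)" by (metis imageE)
  then show ?thesis by (metis Max_ge finite finite_imageI rangeI)
qed

lemma sum_pmf_UNIV: "(\<Sum>x\<in>UNIV. pmf (p :: 'x::finite pmf) x) = 1"
  by (rule sum_pmf_eq_1) auto

lemma pmf_average_le:
  fixes p :: "'x::finite pmf"
  assumes "\<And>x. f x \<le> c"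
  shows "(\<Sum>x\<in>UNIV. pmf p x * f x) \<le> (c::real)"
proof -
  have "(\<Sum>x\<in>UNIV. pmf p x * f x) \<le> (\<Sum>x\<in>UNIV. pmf p x * c)"
    by (intro sum_mono mult_left_mono assms) simp
  also have "\<dots> = c" by (simp add: sum_pmf_UNIV flip: sum_distrib_right)
  finally show ?thesis .
qed

locale finite_mdp =
  fixes P :: "'s::finite \<Rightarrow> 'a::finite \<Rightarrow> 's pmf"
    and r :: "'s \<Rightarrow> 'a \<Rightarrow> real"
    and \<gamma> :: real
  assumes reward: "\<And>s a. r s a \<in> {0..1}"
    and discount: "0 \<le> \<gamma>" "\<gamma> < 1"
begin

abbreviation V where "V \<equiv> V_pol P r \<gamma>"
abbreviation Q where "Q \<equiv> Q_pol P r \<gamma>"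
abbreviation Vstar where "Vstar \<equiv> V_opt P r \<gamma>"
abbreviation Qstar where "Qstar \<equiv> Q_opt P r \<gamma>"
abbreviation Astar where "Astar \<equiv> opt_actions P r \<gamma>"

lemmas V_eq = V_pol_eq[where P=P and r=r and \<gamma>=\<gamma>, OF reward discount]
lemmas Q_eq = Q_pol_eq[where P=P and r=r and \<gamma>=\<gamma>, OF reward discount]

definition avg_next :: "('s \<Rightarrow> 'a pmf) \<Rightarrow> ('s \<Rightarrow> real) \<Rightarrow> 's \<Rightarrow> real" where
  "avg_next \<pi> u s = (\<Sum>a\<in>UNIV. pmf (\<pi> s) a * (\<Sum>s'\<in>UNIV. pmf (P s a) s' * u s'))"

lemma avg_next_le: "(\<And>s'. u s' \<le> c) \<Longrightarrow> avg_next \<pi> u s \<le> c"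
  unfolding avg_next_def by (intro pmf_average_le)

lemma avg_next_diff: "avg_next \<pi> (\<lambda>s. u s - v s) s = avg_next \<pi> u s - avg_next \<pi> v s"
  by (simp add: avg_next_def sum_subtractf right_diff_distrib)

lemma avg_next_sum: "avg_next \<pi> (\<lambda>s. \<Sum>k\<in>K. u k s) s = (\<Sum>k\<in>K. avg_next \<pi> (u k) s)"
proof (induction K rule: infinite_finite_induct)
  case (insert k K)
  then show ?case
    by (simp add: avg_next_def sum.distrib distrib_left)
qed (simp_all add: avg_next_def)

text \<open>
  A discounted maximum principle: at a state where \<open>u\<close> is maximal, the average on the right is at
  most \<open>u\<close> itself. The comparisons of value functions below are instances of it; it stands in for the
  discounted visitation measure.
\<close>

lemma le_discounted_imp_le:
  assumes "\<And>s. u s \<le> c + \<gamma> * avg_next \<pi> u s"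
  shows "u s \<le> c / (1 - \<gamma>)"
proof -
  define m where "m = Max (range u)"
  have le: "u s \<le> m" for s unfolding m_def by (rule Max_ge) auto
  have "m \<in> range u" unfolding m_def by (rule Max_in) auto
  then obtain t where t: "u t = m" by auto
  have "m \<le> c + \<gamma> * avg_next \<pi> u t" using assms[of t] t by simp
  also have "\<dots> \<le> c + \<gamma> * m" using discount by (intro add_left_mono mult_left_mono avg_next_le le)
  finally have "m \<le> c / (1 - \<gamma>)" using discount by (simp add: field_simps)
  with le[of s] show ?thesis by linarith
qed

text \<open>
  The performance difference identity in its one-step form, before unrolling along \<open>\<pi>2\<close>.
\<close>

lemma bellman_diff:
  "V \<pi>2 s - V \<pi>1 s =
     (\<Sum>a\<in>UNIV. (pmf (\<pi>2 s) a - pmf (\<pi>1 s) a) * Q \<pi>1 s a) + \<gamma> * avg_next \<pi>2 (\<lambda>s'. V \<pi>2 s' - V \<pi>1 s') s"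
proof -
  have "(\<Sum>a\<in>UNIV. pmf (\<pi>2 s) a * Q \<pi>2 s a) - (\<Sum>a\<in>UNIV. pmf (\<pi>2 s) a * Q \<pi>1 s a)
      = \<gamma> * avg_next \<pi>2 (\<lambda>s'. V \<pi>2 s' - V \<pi>1 s') s"
    unfolding avg_next_diff
    by (simp add: Q_eq avg_next_def sum_subtractf[symmetric] sum_distrib_left algebra_simps)
  then show ?thesis
    by (simp add: V_eq[of \<pi>1] V_eq[of \<pi>2] left_diff_distrib sum_subtractf)
qed

lemma policy_improvement:
  assumes "\<And>s. (\<Sum>a\<in>UNIV. pmf (\<pi>1 s) a * Q \<pi>1 s a) \<le> (\<Sum>a\<in>UNIV. pmf (\<pi>2 s) a * Q \<pi>1 s a)"
  shows "V \<pi>1 s \<le> V \<pi>2 s"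
proof -
  have "V \<pi>1 s - V \<pi>2 s \<le> 0 / (1 - \<gamma>)" for s
  proof (rule le_discounted_imp_le)
    fix s
    have "avg_next \<pi>2 (\<lambda>s'. V \<pi>1 s' - V \<pi>2 s') s = - avg_next \<pi>2 (\<lambda>s'. V \<pi>2 s' - V \<pi>1 s') s"
      by (simp add: avg_next_diff)
    then show "V \<pi>1 s - V \<pi>2 s \<le> 0 + \<gamma> * avg_next \<pi>2 (\<lambda>s'. V \<pi>1 s' - V \<pi>2 s') s"
      using bellman_diff[of \<pi>2 s \<pi>1] assms[of s]
      by (simp add: left_diff_distrib sum_subtractf)
  qed
  from this[of s] show ?thesis by simp
qed

text \<open>
  Policy iteration without the iteration: among the finitely many deterministic policies, one with
  the largest total value cannot be improved by acting greedily, hence solves the Bellman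
  optimality equation.
\<close>

lemma ex_greedy_for_itself: "\<exists>\<pi>. \<forall>s a. Q \<pi> s a \<le> V \<pi> s"
proof -
  define W where "W d = (\<Sum>s\<in>UNIV. V (\<lambda>s. return_pmf (d s)) s)" for d :: "'s \<Rightarrow> 'a"
  obtain d where d: "\<And>d'. W d' \<le> W d"
    using ex_max_finite_type[of W] by blast
  let ?\<pi> = "\<lambda>s. return_pmf (d s)"
  have "\<exists>a. \<forall>b. Q ?\<pi> s b \<le> Q ?\<pi> s a" for s
    by (rule ex_max_finite_type)
  then obtain e where e: "\<And>s b. Q ?\<pi> s b \<le> Q ?\<pi> s (e s)" by metis
  have pt: "(\<Sum>a\<in>UNIV. pmf (return_pmf c) a * f a) = f c" for c and f :: "'a \<Rightarrow> real"
    by (simp add: pmf_return indicator_def if_distrib[of "\<lambda>x. x * _"] cong: if_cong)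
  have imp: "V ?\<pi> s \<le> V (\<lambda>s. return_pmf (e s)) s" for s
    by (rule policy_improvement) (simp add: pt e)
  have eq: "V ?\<pi> s = V (\<lambda>s. return_pmf (e s)) s" for s
  proof (rule ccontr)
    assume "V ?\<pi> s \<noteq> V (\<lambda>s. return_pmf (e s)) s"
    then have "W d < W e" unfolding W_def
      by (intro sum_strict_mono_ex1) (auto intro: imp bexI[of _ s] simp: less_le)
    with d[of e] show False by simp
  qed
  have "Q ?\<pi> s (e s) = V ?\<pi> s" for s
  proof -
    have "Q (\<lambda>s. return_pmf (e s)) s (e s) = V (\<lambda>s. return_pmf (e s)) s" by (simp add: V_eq pt)
    then show ?thesis using eq by (simp add: Q_eq)
  qed
  then show ?thesis using e by metis
qed

text \<open>
  A policy that is greedy for its own values dominates every policy at every state simultaneously,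
  so the suprema defining the optimal values are attained, all by the same policy.
\<close>

lemma ex_optimal_policy:
  obtains \<pi>o where "\<And>s. V \<pi>o s = Vstar s" "\<And>s a. Q \<pi>o s a = Qstar s a"
    "\<And>\<pi> s. V \<pi> s \<le> Vstar s" "\<And>s a. Qstar s a \<le> Vstar s"
proof -
  obtain \<pi>o where o: "\<And>s a. Q \<pi>o s a \<le> V \<pi>o s" using ex_greedy_for_itself by blast
  have V: "V \<pi> s \<le> V \<pi>o s" for \<pi> s
  proof -
    have "V \<pi> s - V \<pi>o s \<le> 0 / (1 - \<gamma>)" for s
    proof (rule le_discounted_imp_le)
      fix s
      have "(\<Sum>a\<in>UNIV. pmf (\<pi> s) a * Q \<pi>o s a) \<le> V \<pi>o s" by (rule pmf_average_le) (rule o)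
      then show "V \<pi> s - V \<pi>o s \<le> 0 + \<gamma> * avg_next \<pi> (\<lambda>s'. V \<pi> s' - V \<pi>o s') s"
        unfolding bellman_diff[of \<pi> s \<pi>o] by (simp add: left_diff_distrib sum_subtractf V_eq[of \<pi>o, symmetric])
    qed
    from this[of s] show ?thesis by simp
  qed
  have Q: "Q \<pi> s a \<le> Q \<pi>o s a" for \<pi> s a
    unfolding Q_eq using discount V by (intro add_left_mono mult_left_mono sum_mono) auto
  have Vstar: "Vstar s = V \<pi>o s" for s
    unfolding V_opt_def by (rule cSup_eq_maximum) (auto intro: V)
  have Qstar: "Qstar s a = Q \<pi>o s a" for s a
    unfolding Q_opt_def by (rule cSup_eq_maximum) (auto intro: Q)
  show thesis by (rule that[of \<pi>o]) (simp_all add: Vstar Qstar V o)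
qed

lemma V_le_opt: "V \<pi> s \<le> Vstar s" by (metis ex_optimal_policy)

lemma Q_opt_le: "Qstar s a \<le> Vstar s" by (metis ex_optimal_policy)

lemma Q_opt_eq: "Qstar s a = r s a + \<gamma> * (\<Sum>s'\<in>UNIV. pmf (P s a) s' * Vstar s')"
  by (rule ex_optimal_policy) (metis (no_types, lifting) Q_eq sum.cong)

lemma ex_opt_action: "\<exists>a. a \<in> Astar s"
proof (rule ccontr)
  assume "\<not> ?thesis"
  then have lt: "Qstar s a < Vstar s" for a using Q_opt_le[of s a] by (auto simp: opt_actions_def less_le)
  obtain \<pi>o where o: "\<And>s. V \<pi>o s = Vstar s" "\<And>s a. Q \<pi>o s a = Qstar s a"
    using ex_optimal_policy by metis
  define m where "m = Max (range (Qstar s))"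
  have "Vstar s \<le> m"
    unfolding o(1)[symmetric] V_eq o(2) by (rule pmf_average_le) (simp add: m_def)
  moreover have "m \<in> range (Qstar s)" unfolding m_def by (rule Max_in) auto
  ultimately show False using lt by (metis imageE not_less)
qed

text \<open>
  Errors in \<open>Q\<close> are discounted averages of errors in \<open>V\<close>, hence no larger.
\<close>

lemma Q_error_le:
  assumes "\<And>s. Vstar s - V \<pi> s \<le> e"
  shows "Q \<pi> s a \<le> Qstar s a" "Qstar s a - Q \<pi> s a \<le> e"
proof -
  show "Q \<pi> s a \<le> Qstar s a"
    unfolding Q_opt_eq Q_eq using discount V_le_opt by (intro add_left_mono mult_left_mono sum_mono) auto
  have "0 \<le> e" using assms V_le_opt[of \<pi>] by (meson diff_ge_0_iff_ge order_trans)
  have "Qstar s a - Q \<pi> s a = \<gamma> * (\<Sum>s'\<in>UNIV. pmf (P s a) s' * (Vstar s' - V \<pi> s'))"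
    by (simp add: Q_opt_eq Q_eq sum_subtractf right_diff_distrib)
  also have "\<dots> \<le> 1 * e"
    using discount \<open>0 \<le> e\<close> assms V_le_opt by (intro mult_mono pmf_average_le) (auto intro!: sum_nonneg)
  finally show "Qstar s a - Q \<pi> s a \<le> e" by simp
qed

text \<open>
  Against an optimal policy such a \<open>\<pi>\<close> has no one-step disadvantage, and one-step disadvantages
  are all that separates two value functions.
\<close>

lemma supported_on_opt_actions_imp_optimal:
  assumes "\<And>s a. a \<notin> Astar s \<Longrightarrow> pmf (\<pi> s) a = 0"
  shows "\<pi> \<in> optimal_policies P r \<gamma>"
proof -
  obtain \<pi>o where o: "\<And>s. V \<pi>o s = Vstar s" "\<And>s a. Q \<pi>o s a = Qstar s a"
    using ex_optimal_policy by metis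
  have "(\<Sum>a\<in>UNIV. pmf (\<pi> s) a * Q \<pi>o s a) = (\<Sum>a\<in>UNIV. pmf (\<pi> s) a * Vstar s)" for s
    using assms by (intro sum.cong refl) (auto simp: o opt_actions_def)
  then have *: "(\<Sum>a\<in>UNIV. (pmf (\<pi> s) a - pmf (\<pi>o s) a) * Q \<pi>o s a) = 0" for s
    by (simp add: left_diff_distrib sum_subtractf sum_pmf_UNIV o(1) flip: sum_distrib_right V_eq)
  have "Vstar s - V \<pi> s \<le> 0 / (1 - \<gamma>)" for s
  proof (rule le_discounted_imp_le)
    fix s
    show "Vstar s - V \<pi> s \<le> 0 + \<gamma> * avg_next \<pi> (\<lambda>s'. Vstar s' - V \<pi> s') s"
      using bellman_diff[of \<pi> s \<pi>o] unfolding * o(1) avg_next_diff by (simp add: right_diff_distrib)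
  qed
  then have "V \<pi> = Vstar"
    by (intro ext antisym V_le_opt) (metis diff_le_0_iff_le div_0)
  then show ?thesis by (simp add: optimal_policies_def)
qed

end

section \<open>Derivatives of steep mirror maps\<close>

text \<open>
  What remains of a mirror map once its hypotheses are used up: \<open>f\<close> is its restriction to \<open>[0, 1]\<close>
  and \<open>\<phi>\<close> its derivative. The point \<open>1\<close> is treated as interior and \<open>0\<close> as a boundary point where
  \<open>\<phi>\<close> diverges; for a mirror map this is what the two one-sided limits force.
\<close>

locale steep_potential =
  fixes f \<phi> :: "real \<Rightarrow> real"
  assumes deriv: "\<And>x. 0 < x \<Longrightarrow> x \<le> 1 \<Longrightarrow> (f has_real_derivative \<phi> x) (at x)"
    and conv: "convex_on {0..1} f"
    and tangent: "\<And>x y. 0 < x \<Longrightarrow> x \<le> 1 \<Longrightarrow> 0 \<le> y \<Longrightarrow> y \<le> 1 \<Longrightarrow> f x + \<phi> x * (y - x) \<le> f y"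
    and increasing: "\<And>x y. 0 < x \<Longrightarrow> x < y \<Longrightarrow> y \<le> 1 \<Longrightarrow> \<phi> x < \<phi> y"
    and steep: "filterlim \<phi> at_bot (at_right 0)"

lemma mirror_map_finite: "mirror_map \<psi> \<Longrightarrow> x \<in> dom_fun \<psi> \<Longrightarrow> \<psi> x = ereal (fin_part \<psi> x)"
  by (cases "\<psi> x") (auto simp: mirror_map_def proper_fun_def dom_fun_def fin_part_def)

lemma mirror_map_convex_on:
  assumes m: "mirror_map \<psi>"
  shows "convex_on (dom_fun \<psi>) (fin_part \<psi>)"
proof -
  have epi: "convex (epi \<psi>)" using m by (simp add: mirror_map_def)
  have *: "\<psi> (u * x + v * y) \<le> ereal (u * fin_part \<psi> x + v * fin_part \<psi> y)"
    if "x \<in> dom_fun \<psi>" "y \<in> dom_fun \<psi>" "0 \<le> u" "0 \<le> v" "u + v = 1" for x y u v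
  proof -
    have "(x, fin_part \<psi> x) \<in> epi \<psi>" "(y, fin_part \<psi> y) \<in> epi \<psi>"
      using mirror_map_finite[OF m] that by (simp_all add: epi_def)
    from convexD[OF epi this that(3-5)] show ?thesis by (simp add: epi_def)
  qed
  have D: "u * x + v * y \<in> dom_fun \<psi>"
    if "x \<in> dom_fun \<psi>" "y \<in> dom_fun \<psi>" "0 \<le> u" "0 \<le> v" "u + v = 1" for x y u v
    using *[OF that] by (auto simp: dom_fun_def intro: le_less_trans)
  show ?thesis
    unfolding convex_on_def
  proof (intro conjI ballI allI impI)
    show "convex (dom_fun \<psi>)" by (rule convexI) (use D in simp)
    fix x y u v :: real
    assume "x \<in> dom_fun \<psi>" "y \<in> dom_fun \<psi>" "0 \<le> u" "0 \<le> v" "u + v = 1"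
    from *[OF this] mirror_map_finite[OF m D[OF this]]
    show "fin_part \<psi> (u *\<^sub>R x + v *\<^sub>R y) \<le> u * fin_part \<psi> x + v * fin_part \<psi> y" by simp
  qed
qed

context
  fixes \<psi> :: "real \<Rightarrow> ereal"
  assumes m: "mirror_map \<psi>"
begin

lemma mirror_map_has_derivative:
  "x \<in> interior (dom_fun \<psi>) \<Longrightarrow> (fin_part \<psi> has_real_derivative dpsi \<psi> x) (at x)"
  using m by (auto simp: mirror_map_def dpsi_def DERIV_deriv_iff_real_differentiable)

lemma mirror_map_tangent:
  assumes "x \<in> interior (dom_fun \<psi>)" "y \<in> dom_fun \<psi>"
  shows "fin_part \<psi> x + dpsi \<psi> x * (y - x) \<le> fin_part \<psi> y"
proof -
  note c = mirror_map_convex_on[OF m]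
  have "connected (dom_fun \<psi>)"
    using c by (intro convex_connected) (simp add: convex_on_def)
  from convex_on_imp_above_tangent[OF c this assms
      has_field_derivative_at_within[OF mirror_map_has_derivative[OF assms(1)]]]
  show ?thesis by simp
qed

lemma mirror_map_deriv_increasing:
  assumes "x \<in> interior (dom_fun \<psi>)" "y \<in> interior (dom_fun \<psi>)" "x < y"
  shows "dpsi \<psi> x < dpsi \<psi> y"
proof -
  have sc: "strictly_convex_on (interior (dom_fun \<psi>)) (fin_part \<psi>)"
    using m by (simp add: mirror_map_def)
  let ?z = "(1 - 1 / 2) * x + 1 / 2 * y"
  have z: "?z \<in> interior (dom_fun \<psi>)"
    using sc assms(1,2) convexD_alt[of "interior (dom_fun \<psi>)" x y "1/2"]
    by (simp add: strictly_convex_on_def)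
  then have z': "?z \<in> dom_fun \<psi>" using interior_subset by blast
  have "fin_part \<psi> ?z < (1 - 1 / 2) * fin_part \<psi> x + 1 / 2 * fin_part \<psi> y"
    using sc assms unfolding strictly_convex_on_def by (metis half_gt_zero less_irrefl
        zero_less_one divide_less_eq_1_pos one_less_numeral_iff semiring_norm(76) zero_less_numeral)
  moreover have "fin_part \<psi> x + dpsi \<psi> x * (?z - x) \<le> fin_part \<psi> ?z"
    by (rule mirror_map_tangent[OF assms(1) z'])
  moreover have "fin_part \<psi> y + dpsi \<psi> y * (?z - y) \<le> fin_part \<psi> ?z"
    by (rule mirror_map_tangent[OF assms(2) z'])
  ultimately have "dpsi \<psi> x * (y - x) < dpsi \<psi> y * (y - x)"
    by (simp add: field_simps)
  then show ?thesis using assms(3) by simp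
qed

lemma open_unit_in_interior: "0 < x \<Longrightarrow> x < 1 \<Longrightarrow> x \<in> interior (dom_fun \<psi>)"
  using interior_mono[of "{0..1}" "dom_fun \<psi>"] m by (auto simp: mirror_map_def)

text \<open>
  The derivative increases strictly on the interior of the domain, so its values near \<open>0\<close> from the
  right could not tend to \<open>-\<infinity>\<close> if some interior point lay at or to the left of \<open>0\<close>.
\<close>

lemma interior_dom_pos:
  assumes lim0: "((\<lambda>x. ereal (dpsi \<psi> x)) \<longlongrightarrow> -\<infinity>) (at_right 0)"
    and x: "x \<in> interior (dom_fun \<psi>)"
  shows "0 < x"
proof (rule ccontr)
  assume "\<not> 0 < x"
  have "eventually (\<lambda>y. ereal (dpsi \<psi> y) < ereal (dpsi \<psi> x)) (at_right 0)"
    using lim0 by (rule order_tendstoD) simp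
  moreover have "eventually (\<lambda>y::real. y \<in> {0<..<1}) (at_right 0)"
    by (rule eventually_at_right_real) simp
  ultimately have "eventually (\<lambda>y::real. False) (at_right 0)"
  proof eventually_elim
    case (elim y)
    then have "dpsi \<psi> x < dpsi \<psi> y"
      using \<open>\<not> 0 < x\<close> by (intro mirror_map_deriv_increasing x open_unit_in_interior) auto
    with elim show ?case by simp
  qed
  then show False by simp
qed

text \<open>
  Were \<open>1\<close> a boundary point, the blow-up of the derivative there would, by monotonicity, be towards
  \<open>+\<infinity>\<close>, against the assumed limit from the left.
\<close>

lemma one_in_interior:
  assumes lim1: "\<exists>l<\<infinity>. ((\<lambda>x. ereal (dpsi \<psi> x)) \<longlongrightarrow> l) (at_left 1)"
  shows "1 \<in> interior (dom_fun \<psi>)"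
proof (rule ccontr)
  assume no: "1 \<notin> interior (dom_fun \<psi>)"
  have "1 \<in> dom_fun \<psi>" using m by (auto simp: mirror_map_def)
  with no have fr: "1 \<in> frontier (dom_fun \<psi>)"
    using closure_subset by (auto simp: frontier_def)
  define X where "X n = 1 - 1 / real (n + 2)" for n
  have X: "1 / 2 \<le> X n" "X n < 1" for n by (auto simp: X_def field_simps)
  have X1: "X \<longlonglongrightarrow> 1" unfolding X_def by real_asymp
  have Xi: "X n \<in> interior (dom_fun \<psi>)" for n
    using X[of n] by (intro open_unit_in_interior) auto
  have top: "filterlim (\<lambda>n. \<bar>dpsi \<psi> (X n)\<bar>) at_top sequentially"
    using m X1 Xi fr unfolding mirror_map_def by blast
  have lower: "dpsi \<psi> (1/2) \<le> dpsi \<psi> (X n)" for n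
  proof (cases "X n = 1 / 2")
    case True
    then show ?thesis by (simp only: order_refl)
  next
    case False
    with X[of n] have "1 / 2 < X n" by simp
    then have "dpsi \<psi> (1/2) < dpsi \<psi> (X n)"
      by (intro mirror_map_deriv_increasing Xi open_unit_in_interior) auto
    then show ?thesis by simp
  qed
  obtain l where l: "l < \<infinity>" "((\<lambda>x. ereal (dpsi \<psi> x)) \<longlongrightarrow> l) (at_left 1)" using lim1 by auto
  have "filterlim X (at_left 1) sequentially"
    using X1 X(2) by (simp add: filterlim_at less_imp_neq)
  from filterlim_compose[OF l(2) this] have lX: "(\<lambda>n. ereal (dpsi \<psi> (X n))) \<longlonglongrightarrow> l" .
  \<comment> \<open>A bound on both sides for the derivative along \<open>X\<close>; the case \<open>l = -\<infinity>\<close> is harmless because of \<open>lower\<close>.\<close>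
  obtain B where B: "l < ereal B" "dpsi \<psi> (1/2) > - B"
  proof (cases l)
    case (real b)
    then show ?thesis by (intro that[of "max b (- dpsi \<psi> (1/2)) + 1"]) auto
  next
    case MInf
    then show ?thesis by (intro that[of "- dpsi \<psi> (1/2) + 1"]) auto
  qed (use l in auto)
  have "eventually (\<lambda>n. ereal (dpsi \<psi> (X n)) < ereal B) sequentially"
    using lX B(1) by (rule order_tendstoD)
  moreover have "eventually (\<lambda>n. \<bar>dpsi \<psi> (X n)\<bar> > B) sequentially"
    using top by (simp add: filterlim_at_top_dense)
  ultimately have "eventually (\<lambda>n::nat. False) sequentially"
  proof eventually_elim
    case (elim n)
    with lower[of n] B(2) show ?case by auto
  qed
  then show False by simp
qed

lemma half_open_unit_in_interior:
  assumes lim1: "\<exists>l<\<infinity>. ((\<lambda>x. ereal (dpsi \<psi> x)) \<longlongrightarrow> l) (at_left 1)"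
    and "0 < x" "x \<le> 1"
  shows "x \<in> interior (dom_fun \<psi>)"
  using assms open_unit_in_interior one_in_interior[OF lim1] by (cases "x = 1") auto

lemma steep_potential_mirror_map:
  assumes lim0: "((\<lambda>x. ereal (dpsi \<psi> x)) \<longlongrightarrow> -\<infinity>) (at_right 0)"
    and lim1: "\<exists>l<\<infinity>. ((\<lambda>x. ereal (dpsi \<psi> x)) \<longlongrightarrow> l) (at_left 1)"
  shows "steep_potential (fin_part \<psi>) (dpsi \<psi>)"
proof
  have sub: "{0..1} \<subseteq> dom_fun \<psi>" using m by (simp add: mirror_map_def)
  show "convex_on {0..1} (fin_part \<psi>)"
    by (rule convex_on_subset[OF mirror_map_convex_on[OF m] sub]) simp
  show "filterlim (dpsi \<psi>) at_bot (at_right 0)"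
    using lim0 by (simp add: tendsto_MInfty filterlim_at_bot_dense)
  fix x y :: real
  show "(fin_part \<psi> has_real_derivative dpsi \<psi> x) (at x)" if "0 < x" "x \<le> 1"
    using that by (intro mirror_map_has_derivative half_open_unit_in_interior[OF lim1])
  show "fin_part \<psi> x + dpsi \<psi> x * (y - x) \<le> fin_part \<psi> y"
    if "0 < x" "x \<le> 1" "0 \<le> y" "y \<le> 1"
    using that sub by (intro mirror_map_tangent half_open_unit_in_interior[OF lim1]) auto
  show "dpsi \<psi> x < dpsi \<psi> y" if "0 < x" "x < y" "y \<le> 1"
    using that by (intro mirror_map_deriv_increasing half_open_unit_in_interior[OF lim1]) auto
qed

end

section \<open>The proximal step\<close>

context steep_potential
begin

text \<open>
  If a coordinate of the minimizer vanished, moving a fraction \<open>t\<close> towards the uniform vector would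
  change the objective by at most \<open>t\<close> times the sum of \<open>q * \<phi> (t * q)\<close> and a constant. This is
  negative for small \<open>t\<close> because \<open>\<phi>\<close> is unbounded below at \<open>0\<close>.
\<close>

lemma minimizer_pos:
  fixes x c :: "'a::finite \<Rightarrow> real"
  assumes x: "\<And>a. 0 \<le> x a" "(\<Sum>a\<in>UNIV. x a) = 1"
    and min: "\<And>y. (\<And>a. 0 \<le> y a) \<Longrightarrow> (\<Sum>a\<in>UNIV. y a) = 1 \<Longrightarrow>
      (\<Sum>a\<in>UNIV. f (x a) - c a * x a) \<le> (\<Sum>a\<in>UNIV. f (y a) - c a * y a)"
  shows "0 < x a"
proof (rule ccontr)
  assume "\<not> 0 < x a"
  with x(1)[of a] have xa: "x a = 0" by simp
  define q where "q = 1 / real CARD('a)"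
  have q: "0 < q" "q \<le> 1" by (simp_all add: q_def Suc_leI)
  have x1: "x b \<le> 1" for b using x member_le_sum[of b UNIV x] by auto
  define S where "S = (\<Sum>b\<in>UNIV-{a}. f q - f (x b)) - (\<Sum>b\<in>UNIV. c b * (q - x b))"
  have "eventually (\<lambda>z. \<phi> z < - S / q) (at_right 0)"
    using steep by (simp add: filterlim_at_bot_dense)
  moreover have "eventually (\<lambda>z. z \<in> {0<..<q}) (at_right 0)"
    by (rule eventually_at_right_real) (rule q)
  ultimately have "eventually (\<lambda>z. \<phi> z < - S / q \<and> z \<in> {0<..<q}) (at_right 0)"
    by eventually_elim auto
  \<comment> \<open>\<open>z\<close> is the new value of the coordinate \<open>a\<close>, reached for \<open>t = z / q\<close>.\<close>
  then obtain z where z: "\<phi> z < - S / q" "0 < z" "z < q"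
    using eventually_happens[of _ "at_right (0::real)"] by auto
  define t where "t = z / q"
  have t: "0 < t" "t < 1" "t * q = z" using z q by (simp_all add: t_def)
  define y where "y b = (1 - t) * x b + t * q" for b
  have "(\<Sum>b\<in>UNIV. f (x b) - c b * x b) \<le> (\<Sum>b\<in>UNIV. f (y b) - c b * y b)"
  proof (rule min)
    show "0 \<le> y b" for b unfolding y_def using t q x
      by (intro add_nonneg_nonneg mult_nonneg_nonneg) auto
    show "(\<Sum>b\<in>UNIV. y b) = 1"
      using x(2) by (simp add: y_def sum.distrib q_def flip: sum_distrib_left)
  qed
  then have "0 \<le> (\<Sum>b\<in>UNIV. f (y b) - f (x b)) - (\<Sum>b\<in>UNIV. c b * (y b - x b))"
    by (simp add: sum_subtractf right_diff_distrib)
  also have "(\<Sum>b\<in>UNIV. c b * (y b - x b)) = t * (\<Sum>b\<in>UNIV. c b * (q - x b))"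
    unfolding sum_distrib_left by (rule sum.cong) (auto simp: y_def algebra_simps)
  also have "(\<Sum>b\<in>UNIV. f (y b) - f (x b)) = (f z - f 0) + (\<Sum>b\<in>UNIV-{a}. f (y b) - f (x b))"
    by (subst sum.remove[of _ a]) (auto simp: y_def xa t)
  also have "f z - f 0 \<le> t * q * \<phi> z"
    unfolding t(3) using tangent[of z 0] z q by (simp add: algebra_simps)
  also have "(\<Sum>b\<in>UNIV-{a}. f (y b) - f (x b)) \<le> (\<Sum>b\<in>UNIV-{a}. t * (f q - f (x b)))"
  proof (rule sum_mono)
    fix b
    have "f (y b) \<le> (1 - t) * f (x b) + t * f q"
      using convex_onD[OF conv, of t "x b" q] t q x x1 by (simp add: y_def)
    then show "f (y b) - f (x b) \<le> t * (f q - f (x b))" by (simp add: algebra_simps)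
  qed
  also have "t * q * \<phi> z + (\<Sum>b\<in>UNIV-{a}. t * (f q - f (x b))) - t * (\<Sum>b\<in>UNIV. c b * (q - x b))
      = t * (q * \<phi> z + S)"
    by (simp add: S_def algebra_simps sum_distrib_left)
  also have "\<dots> < 0"
    using z q t by (intro mult_pos_neg) (simp_all add: field_simps)
  finally show False by simp
qed

text \<open>
  The minimizer has positive coordinates, so a little mass can be moved from \<open>b\<close> to \<open>a\<close> or back;
  the derivative along this direction must vanish. The common value is the Lagrange multiplier of the
  constraint that the coordinates sum to \<open>1\<close>.
\<close>

lemma minimizer_stationary:
  fixes x c :: "'a::finite \<Rightarrow> real"
  assumes x: "\<And>a. 0 \<le> x a" "(\<Sum>a\<in>UNIV. x a) = 1"
    and min: "\<And>y. (\<And>a. 0 \<le> y a) \<Longrightarrow> (\<Sum>a\<in>UNIV. y a) = 1 \<Longrightarrow>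
      (\<Sum>a\<in>UNIV. f (x a) - c a * x a) \<le> (\<Sum>a\<in>UNIV. f (y a) - c a * y a)"
  shows "\<phi> (x a) - c a = \<phi> (x b) - c b"
proof (cases "a = b")
  case False
  have pos: "0 < x a" for a using minimizer_pos[OF assms] by blast
  have x1: "x b \<le> 1" for b using x member_le_sum[of b UNIV x] by auto
  define g where "g t = f (x a + t) - c a * (x a + t) + (f (x b - t) - c b * (x b - t))" for t
  have split: "(\<Sum>d\<in>UNIV. h d) = h a + h b + (\<Sum>d\<in>UNIV-{a,b}. h d)" for h :: "'a \<Rightarrow> real"
    using False sum.subset_diff[of "{a,b}" UNIV h] by simp
  have D: "(g has_real_derivative (\<phi> (x a) - c a) - (\<phi> (x b) - c b)) (at 0)"
  proof -
    have "((\<lambda>t. f (x a + t)) has_real_derivative \<phi> (x a)) (at 0)"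
      using deriv[OF pos x1, of a] DERIV_shift[of f "\<phi> (x a)" 0 "x a"] by (simp add: add.commute)
    moreover have "((\<lambda>t. f (x b - t)) has_real_derivative - \<phi> (x b)) (at 0)"
      by (rule DERIV_chain2[of f "\<phi> (x b)" "\<lambda>t. x b - t" 0 "-1", simplified])
        (auto intro!: derivative_eq_intros deriv pos x1)
    ultimately show ?thesis
      unfolding g_def by (auto intro!: derivative_eq_intros)
  qed
  have M: "g 0 \<le> g t" if "\<bar>t\<bar> < min (x a) (x b)" for t
  proof -
    define y where "y = x(a := x a + t, b := x b - t)"
    have "(\<Sum>d\<in>UNIV. f (x d) - c d * x d) \<le> (\<Sum>d\<in>UNIV. f (y d) - c d * y d)"
    proof (rule min)
      show "0 \<le> y d" for d using that x by (auto simp: y_def)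
      show "(\<Sum>d\<in>UNIV. y d) = 1" using False x(2) unfolding split by (simp add: y_def)
    qed
    then show ?thesis using False unfolding split by (simp add: y_def g_def)
  qed
  have "(\<phi> (x a) - c a) - (\<phi> (x b) - c b) = 0"
    by (rule DERIV_local_min[OF D, of "min (x a) (x b)"]) (use pos M in auto)
  then show ?thesis by simp
qed simp

definition breg :: "('a::finite \<Rightarrow> real) \<Rightarrow> ('a \<Rightarrow> real) \<Rightarrow> real" where
  "breg u x = (\<Sum>a\<in>UNIV. f (u a) - f (x a) - \<phi> (x a) * (u a - x a))"

lemma breg_nonneg:
  "(\<And>a. 0 \<le> u a \<and> u a \<le> 1) \<Longrightarrow> (\<And>a. 0 < x a \<and> x a \<le> 1) \<Longrightarrow> 0 \<le> breg u x"
  unfolding breg_def by (rule sum_nonneg) (use tangent in \<open>smt (verit)\<close>)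

text \<open>
  The multiplier drops out because \<open>u\<close> and \<open>p\<close> have the same total mass; what is left is the
  algebraic identity for three Bregman divergences.
\<close>

lemma three_point:
  assumes sums: "(\<Sum>a\<in>UNIV. u a) = (\<Sum>a\<in>UNIV. p a)"
    and stat: "\<And>a b. \<phi> (p a) - \<phi> (q a) - g a = \<phi> (p b) - \<phi> (q b) - g b"
  shows "(\<Sum>a\<in>UNIV. g a * (u a - p a)) = breg u q - breg u p - breg p q"
proof -
  obtain c where c: "\<And>a. \<phi> (p a) - \<phi> (q a) - g a = c" using stat by metis
  have g: "g a = \<phi> (p a) - \<phi> (q a) - c" for a
    using c[of a] by simp
  have "(\<Sum>a\<in>UNIV. g a * (u a - p a)) =
      (\<Sum>a\<in>UNIV. (\<phi> (p a) - \<phi> (q a)) * (u a - p a) - c * (u a - p a))"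
    unfolding g by (simp add: left_diff_distrib)
  also have "\<dots> = (\<Sum>a\<in>UNIV. (\<phi> (p a) - \<phi> (q a)) * (u a - p a))"
    using sums by (simp add: sum_subtractf flip: sum_distrib_left)
  also have "\<dots> = breg u q - breg u p - breg p q"
    unfolding breg_def sum_subtractf[symmetric] by (intro sum.cong) (auto simp: algebra_simps)
  finally show ?thesis .
qed

end

section \<open>Policy updates as minimization over the simplex\<close>

lemma ex_pmf_of_vector:
  fixes x :: "'a::finite \<Rightarrow> real"
  assumes "\<And>a. 0 \<le> x a" "(\<Sum>a\<in>UNIV. x a) = 1"
  obtains p where "\<And>a. pmf p a = x a"
proof -
  have "(\<integral>\<^sup>+a. ennreal (x a) \<partial>count_space UNIV) = 1"
    using assms by (simp add: nn_integral_count_space_finite sum_ennreal)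
  then have "pmf (embed_pmf x) a = x a" for a
    using assms by (intro pmf_embed_pmf) auto
  then show thesis by (rule that)
qed

lemma GDERIV_imp_gradient_eq: "GDERIV F x :> D \<Longrightarrow> gradient F x = D"
  unfolding gradient_def
proof (rule the_equality)
  fix D' assume "GDERIV F x :> D" "GDERIV F x :> D'"
  then have "(\<lambda>h. inner h D) = (\<lambda>h. inner h D')"
    unfolding gderiv_def by (rule has_derivative_unique)
  then show "D' = D" by (metis vector_eq_ldot)
qed

context
  fixes \<psi> :: "real \<Rightarrow> ereal"
  assumes m: "mirror_map \<psi>"
begin

lemma h_map_eq:
  fixes x :: "real ^ 'a::finite"
  shows "(\<And>a. x $ a \<in> dom_fun \<psi>) \<Longrightarrow> h_map \<psi> x = ereal (\<Sum>a\<in>UNIV. fin_part \<psi> (x $ a))"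
  by (simp add: h_map_def mirror_map_finite[OF m])

lemma GDERIV_h_map:
  fixes x :: "real ^ 'a::finite"
  assumes x: "\<And>a. x $ a \<in> interior (dom_fun \<psi>)"
  shows "GDERIV (fin_part (h_map \<psi>)) x :> (\<chi> a. dpsi \<psi> (x $ a))"
proof -
  define U where "U = {y :: real ^ 'a. \<forall>a. y $ a \<in> interior (dom_fun \<psi>)}"
  have "open U" unfolding U_def Collect_all_eq
    by (intro open_INT ballI) (auto intro!: open_vimage[unfolded vimage_def] continuous_intros)
  note d = mirror_map_has_derivative[OF m x]
  have D: "((\<lambda>y. \<Sum>a\<in>UNIV. fin_part \<psi> (y $ a)) has_derivative (\<lambda>v. \<Sum>a\<in>UNIV. dpsi \<psi> (x $ a) * v $ a)) (at x)"
  proof (rule has_derivative_sum)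
    fix a :: 'a
    have "((\<lambda>y. y $ a) has_derivative (\<lambda>v. v $ a)) (at x)"
      by (rule bounded_linear.has_derivative[OF bounded_linear_vec_nth has_derivative_ident])
    from has_derivative_compose[OF this d[unfolded has_field_derivative_def]]
    show "((\<lambda>y. fin_part \<psi> (y $ a)) has_derivative (\<lambda>v. dpsi \<psi> (x $ a) * v $ a)) (at x)" .
  qed
  have eq: "(\<Sum>a\<in>UNIV. fin_part \<psi> (y $ a)) = fin_part (h_map \<psi>) y" if "y \<in> U" for y
  proof -
    have "y $ a \<in> dom_fun \<psi>" for a using that interior_subset by (auto simp: U_def)
    then show ?thesis by (simp add: fin_part_def[of "h_map \<psi>"] h_map_eq)
  qed
  have "(fin_part (h_map \<psi>) has_derivative (\<lambda>v. \<Sum>a\<in>UNIV. dpsi \<psi> (x $ a) * v $ a)) (at x)"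
    by (rule has_derivative_transform_within_open[OF D \<open>open U\<close> _ eq]) (simp_all add: U_def x)
  then show ?thesis
    by (simp add: gderiv_def inner_vec_def mult.commute)
qed

lemma bregman_h_map:
  fixes x y :: "real ^ 'a::finite"
  assumes "\<And>a. x $ a \<in> interior (dom_fun \<psi>)" "\<And>a. y $ a \<in> dom_fun \<psi>"
  shows "bregman (h_map \<psi>) y x = ereal (\<Sum>a\<in>UNIV.
      fin_part \<psi> (y $ a) - fin_part \<psi> (x $ a) - dpsi \<psi> (x $ a) * (y $ a - x $ a))"
proof -
  have "x $ a \<in> dom_fun \<psi>" for a using assms(1) interior_subset by blast
  then show ?thesis
    unfolding bregman_def GDERIV_imp_gradient_eq[OF GDERIV_h_map[OF assms(1)]]
    using assms(2) by (simp add: h_map_eq inner_vec_def sum_subtractf)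
qed

end

text \<open>
  On the simplex all terms are finite. Dropping what does not depend on the new policy turns the
  update into the minimization of a separable convex function minus a linear one, over vectors
  instead of \<open>pmf\<close>s.
\<close>

lemma pmd_step_minimizes:
  fixes q p :: "'a::finite pmf" and g :: "'a \<Rightarrow> real"
  assumes m: "mirror_map \<psi>"
    and q: "\<And>a. pmf q a \<in> interior (dom_fun \<psi>)"
    and max: "is_arg_max (\<lambda>p. ereal (\<eta> * (prob_vec p \<bullet> (\<chi> a. g a))) - bregman (h_map \<psi>) (prob_vec p) (prob_vec q))
      (\<lambda>p. p \<in> UNIV) p"
    and y: "\<And>a. 0 \<le> y a" "(\<Sum>a\<in>UNIV. y a) = 1"
  defines "c \<equiv> \<lambda>a. dpsi \<psi> (pmf q a) + \<eta> * g a"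
  shows "(\<Sum>a\<in>UNIV. fin_part \<psi> (pmf p a) - c a * pmf p a) \<le> (\<Sum>a\<in>UNIV. fin_part \<psi> (y a) - c a * y a)"
proof -
  obtain p' where p': "\<And>a. pmf p' a = y a" using ex_pmf_of_vector[OF y] by blast
  have dom: "pmf p a \<in> dom_fun \<psi>" for p :: "'a pmf" and a
    using m pmf_le_1[of p a] by (auto simp: mirror_map_def)
  let ?C = "(\<Sum>a\<in>UNIV. fin_part \<psi> (pmf q a) - dpsi \<psi> (pmf q a) * pmf q a)"
  have "ereal (\<eta> * (prob_vec p \<bullet> (\<chi> a. g a))) - bregman (h_map \<psi>) (prob_vec p) (prob_vec q)
      = ereal (?C - (\<Sum>a\<in>UNIV. fin_part \<psi> (pmf p a) - c a * pmf p a))" for p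
    using bregman_h_map[OF m, of "prob_vec q" "prob_vec p"] q dom
    by (simp add: prob_vec_def inner_vec_def c_def sum_distrib_left sum_subtractf sum.distrib algebra_simps)
  with max have "\<not> ?C - (\<Sum>a\<in>UNIV. fin_part \<psi> (pmf p a) - c a * pmf p a)
      < ?C - (\<Sum>a\<in>UNIV. fin_part \<psi> (pmf p' a) - c a * pmf p' a)"
    by (simp add: is_arg_max_def)
  then show ?thesis by (simp add: p')
qed

section \<open>Convergence from potential differences\<close>

lemma convergent_if_unique_limit_point:
  fixes x :: "nat \<Rightarrow> 'b::metric_space"
  assumes S: "compact S" "\<And>n. x n \<in> S"
    and unique: "\<And>r1 r2 l1 l2. strict_mono r1 \<Longrightarrow> strict_mono r2 \<Longrightarrow>
      (x \<circ> r1) \<longlonglongrightarrow> l1 \<Longrightarrow> (x \<circ> r2) \<longlonglongrightarrow> l2 \<Longrightarrow> l1 = l2"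
  shows "convergent x"
proof -
  have seq: "seq_compact S" using S(1) by (simp add: compact_imp_seq_compact)
  obtain l r where r: "strict_mono r" "(x \<circ> r) \<longlonglongrightarrow> l"
    using seq_compactE[OF seq, of x] S(2) by metis
  have "x \<longlonglongrightarrow> l"
  proof (rule ccontr)
    assume "\<not> ?thesis"
    then obtain e where e: "e > 0" "\<not> eventually (\<lambda>n. dist (x n) l < e) sequentially"
      by (auto simp: tendsto_iff)
    then have inf: "infinite {n. e \<le> dist (x n) l}"
      by (simp add: not_eventually not_less frequently_cofinite flip: cofinite_eq_sequentially)
    obtain r' :: "nat \<Rightarrow> nat" where r': "strict_mono r'" "\<And>n. r' n \<in> {n. e \<le> dist (x n) l}"
      using infinite_enumerate[OF inf] by blast
    obtain l' r'' where r'': "strict_mono r''" "((x \<circ> r') \<circ> r'') \<longlonglongrightarrow> l'"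
      using seq_compactE[OF seq, of "x \<circ> r'"] S(2) by (metis comp_apply)
    have "l' = l"
      using unique[of "r' \<circ> r''" r l' l] r r' r'' by (simp add: strict_mono_o comp_assoc)
    then have "eventually (\<lambda>n. dist (x (r' (r'' n))) l < e) sequentially"
      using r''(2) e(1) by (auto simp: tendsto_iff)
    then have "eventually (\<lambda>n::nat. False) sequentially"
      by eventually_elim (use r'(2) in \<open>auto simp: not_less[symmetric]\<close>)
    then show False by simp
  qed
  then show ?thesis by (rule convergentI)
qed

context steep_potential
begin

lemma \<phi>_mono: "0 < x \<Longrightarrow> x \<le> y \<Longrightarrow> y \<le> 1 \<Longrightarrow> \<phi> x \<le> \<phi> y"
  using increasing[of x y] by (cases "x = y") auto

lemma tendsto_zero_if_potential_at_bot:
  assumes x: "\<And>k. 0 < x k \<and> x k \<le> 1" and "filterlim (\<lambda>k. \<phi> (x k)) at_bot sequentially"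
  shows "x \<longlonglongrightarrow> 0"
proof (rule tendstoI)
  fix e :: real assume "0 < e"
  define e' where "e' = min e 1"
  have e': "0 < e'" "e' \<le> 1" "e' \<le> e" using \<open>0 < e\<close> by (auto simp: e'_def)
  have "eventually (\<lambda>k. \<phi> (x k) < \<phi> e') sequentially"
    using assms(2) by (simp add: filterlim_at_bot_dense)
  then show "eventually (\<lambda>k. dist (x k) 0 < e) sequentially"
  proof eventually_elim
    case (elim k)
    then have "x k < e'" using \<phi>_mono[of e' "x k"] x[of k] e' by force
    with x[of k] e' show ?case by (auto simp: dist_real_def)
  qed
qed

text \<open>
  Two limit points cannot order two coordinates in opposite ways, for otherwise the potential
  difference would have different limits along the two subsequences. The intermediate points
  \<open>\<alpha>1 < \<alpha>2\<close> and \<open>\<beta>2 < \<beta>1\<close> leave a gap between the potential differences that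
  survives passing to the limit.
\<close>

lemma not_reversed_limits:
  assumes x: "\<And>k. 0 < x k \<and> x k \<le> 1" "\<And>k. 0 < x' k \<and> x' k \<le> 1"
    and d: "(\<lambda>k. \<phi> (x k) - \<phi> (x' k)) \<longlonglongrightarrow> d"
    and r: "strict_mono r1" "strict_mono r2"
    and l1: "(x \<circ> r1) \<longlonglongrightarrow> u1" "(x' \<circ> r1) \<longlonglongrightarrow> v1"
    and l2: "(x \<circ> r2) \<longlonglongrightarrow> u2" "(x' \<circ> r2) \<longlonglongrightarrow> v2"
    and "u1 < u2"
  shows "\<not> v2 < v1"
proof
  assume "v2 < v1"
  have rng: "0 \<le> u1" "u2 \<le> 1" "0 \<le> v2" "v1 \<le> 1"
    using x by (auto intro!: LIMSEQ_le_const[OF l1(1)] LIMSEQ_le_const2[OF l2(1)]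
        LIMSEQ_le_const[OF l2(2)] LIMSEQ_le_const2[OF l1(2)] simp: less_imp_le)
  define \<alpha>1 where "\<alpha>1 = (2 * u1 + u2) / 3"
  define \<alpha>2 where "\<alpha>2 = (u1 + 2 * u2) / 3"
  define \<beta>1 where "\<beta>1 = (2 * v1 + v2) / 3"
  define \<beta>2 where "\<beta>2 = (v1 + 2 * v2) / 3"
  have \<alpha>: "u1 < \<alpha>1" "\<alpha>1 < \<alpha>2" "\<alpha>2 < u2" using \<open>u1 < u2\<close> by (simp_all add: \<alpha>1_def \<alpha>2_def)
  have \<beta>: "v2 < \<beta>2" "\<beta>2 < \<beta>1" "\<beta>1 < v1" using \<open>v2 < v1\<close> by (simp_all add: \<beta>1_def \<beta>2_def)
  have "eventually (\<lambda>k. (x \<circ> r1) k < \<alpha>1 \<and> (x' \<circ> r1) k > \<beta>1) sequentially"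
    using order_tendstoD(2)[OF l1(1) \<alpha>(1)] order_tendstoD(1)[OF l1(2) \<beta>(3)] by eventually_elim auto
  then have "eventually (\<lambda>k. ((\<lambda>k. \<phi> (x k) - \<phi> (x' k)) \<circ> r1) k \<le> \<phi> \<alpha>1 - \<phi> \<beta>1) sequentially"
  proof eventually_elim
    case (elim k)
    then show ?case
      using \<phi>_mono[of "x (r1 k)" \<alpha>1] \<phi>_mono[of \<beta>1 "x' (r1 k)"] x[of "r1 k"] rng \<alpha> \<beta> by auto
  qed
  from tendsto_upperbound[OF LIMSEQ_subseq_LIMSEQ[OF d r(1)] this]
  have "d \<le> \<phi> \<alpha>1 - \<phi> \<beta>1" by simp
  have "eventually (\<lambda>k. (x \<circ> r2) k > \<alpha>2 \<and> (x' \<circ> r2) k < \<beta>2) sequentially"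
    using order_tendstoD(1)[OF l2(1) \<alpha>(3)] order_tendstoD(2)[OF l2(2) \<beta>(1)] by eventually_elim auto
  then have "eventually (\<lambda>k. ((\<lambda>k. \<phi> (x k) - \<phi> (x' k)) \<circ> r2) k \<ge> \<phi> \<alpha>2 - \<phi> \<beta>2) sequentially"
  proof eventually_elim
    case (elim k)
    then show ?case
      using \<phi>_mono[of \<alpha>2 "x (r2 k)"] \<phi>_mono[of "x' (r2 k)" \<beta>2] x[of "r2 k"] rng \<alpha> \<beta> by auto
  qed
  from tendsto_lowerbound[OF LIMSEQ_subseq_LIMSEQ[OF d r(2)] this]
  have "\<phi> \<alpha>2 - \<phi> \<beta>2 \<le> d" by simp
  moreover have "\<phi> \<alpha>1 < \<phi> \<alpha>2" "\<phi> \<beta>2 < \<phi> \<beta>1"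
    using rng \<alpha> \<beta> by (auto intro!: increasing)
  ultimately show False using \<open>d \<le> \<phi> \<alpha>1 - \<phi> \<beta>1\<close> by linarith
qed

text \<open>
  Two distinct limit points, both of total mass \<open>1\<close>, would order some two coordinates in opposite
  ways; those lie in \<open>B\<close>, since the others vanish in the limit, and \<open>not_reversed_limits\<close> applies.
  For positivity: some coordinate in \<open>B\<close> keeps positive mass, and if another one in \<open>B\<close> vanished,
  their potential difference would be unbounded.
\<close>

lemma simplex_sequence_converges:
  fixes x :: "nat \<Rightarrow> real ^ 'a::finite"
  assumes pos: "\<And>k a. 0 < x k $ a" and sum1: "\<And>k. (\<Sum>a\<in>UNIV. x k $ a) = 1"
    and out: "\<And>a. a \<notin> B \<Longrightarrow> (\<lambda>k. x k $ a) \<longlonglongrightarrow> 0"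
    and diff: "\<And>a b. a \<in> B \<Longrightarrow> b \<in> B \<Longrightarrow> convergent (\<lambda>k. \<phi> (x k $ a) - \<phi> (x k $ b))"
  obtains l where "x \<longlonglongrightarrow> l" "\<And>a. a \<notin> B \<Longrightarrow> l $ a = 0" "\<And>a. a \<in> B \<Longrightarrow> 0 < l $ a"
    "(\<Sum>a\<in>UNIV. l $ a) = 1"
proof -
  have x1: "x k $ a \<le> 1" for k a
    using member_le_sum[of a UNIV "\<lambda>a. x k $ a"] pos sum1 by (simp add: less_imp_le)
  have px: "0 < x k $ a \<and> x k $ a \<le> 1" for k a using pos x1 by blast
  have "norm (x k) \<le> 1" for k
    using norm_le_l1_cart[of "x k"] sum1[of k] pos[of k] by (simp add: abs_of_pos)
  have "convergent x"
  proof (rule convergent_if_unique_limit_point[of "cball 0 1"])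
    show "compact (cball 0 1 :: (real ^ 'a) set)" by simp
    show "x n \<in> cball 0 1" for n using \<open>norm (x n) \<le> 1\<close> by simp
    fix r1 r2 l1 l2
    assume r: "strict_mono r1" "strict_mono r2" and l: "(x \<circ> r1) \<longlonglongrightarrow> l1" "(x \<circ> r2) \<longlonglongrightarrow> l2"
    have comp: "((\<lambda>k. x k $ a) \<circ> r1) \<longlonglongrightarrow> l1 $ a" "((\<lambda>k. x k $ a) \<circ> r2) \<longlonglongrightarrow> l2 $ a" for a
      using tendsto_vec_nth[OF l(1), of a] tendsto_vec_nth[OF l(2), of a] by (simp_all add: comp_def)
    have l0: "l1 $ a = 0" "l2 $ a = 0" if "a \<notin> B" for a
      using LIMSEQ_subseq_LIMSEQ[OF out[OF that] r(1)] LIMSEQ_subseq_LIMSEQ[OF out[OF that] r(2)]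
        comp[of a] by (auto intro: LIMSEQ_unique)
    have "(\<lambda>k. \<Sum>a\<in>UNIV. (x \<circ> r1) k $ a) \<longlonglongrightarrow> (\<Sum>a\<in>UNIV. l1 $ a)"
      "(\<lambda>k. \<Sum>a\<in>UNIV. (x \<circ> r2) k $ a) \<longlonglongrightarrow> (\<Sum>a\<in>UNIV. l2 $ a)"
      by (intro tendsto_intros l)+
    then have s: "(\<Sum>a\<in>UNIV. l1 $ a) = 1" "(\<Sum>a\<in>UNIV. l2 $ a) = 1"
      by (simp_all add: sum1 LIMSEQ_const_iff)
    have no: False if a: "l1 $ a < l2 $ a" and b: "l2 $ b < l1 $ b" for a b
    proof -
      have "a \<in> B" "b \<in> B" using a b l0 by force+
      then obtain d where d: "(\<lambda>k. \<phi> (x k $ a) - \<phi> (x k $ b)) \<longlonglongrightarrow> d"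
        using diff by (auto simp: convergent_def)
      from not_reversed_limits[OF px px d r comp(1) comp(1) comp(2) comp(2) a] b
      show False by blast
    qed
    show "l1 = l2"
    proof (rule ccontr)
      assume "l1 \<noteq> l2"
      then obtain a where "l1 $ a \<noteq> l2 $ a" by (auto simp: vec_eq_iff)
      then consider "l1 $ a < l2 $ a" | "l2 $ a < l1 $ a" by linarith
      then show False
      proof cases
        case 1
        then have "(\<Sum>a\<in>UNIV. l1 $ a) < (\<Sum>a\<in>UNIV. l2 $ a)"
          using no by (intro sum_strict_mono_ex1) (auto simp: not_less[symmetric])
        then show False using s by simp
      next
        case 2
        then have "(\<Sum>a\<in>UNIV. l2 $ a) < (\<Sum>a\<in>UNIV. l1 $ a)"
          using no by (intro sum_strict_mono_ex1) (auto simp: not_less[symmetric])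
        then show False using s by simp
      qed
    qed
  qed
  then obtain l where l: "x \<longlonglongrightarrow> l" by (auto simp: convergent_def)
  have comp: "(\<lambda>k. x k $ a) \<longlonglongrightarrow> l $ a" for a by (rule tendsto_vec_nth[OF l])
  have "(\<lambda>k. \<Sum>a\<in>UNIV. x k $ a) \<longlonglongrightarrow> (\<Sum>a\<in>UNIV. l $ a)" by (intro tendsto_intros l)
  then have s: "(\<Sum>a\<in>UNIV. l $ a) = 1" by (simp add: sum1 LIMSEQ_const_iff)
  have l0: "l $ a = 0" if "a \<notin> B" for a using comp[of a] out[OF that] by (rule LIMSEQ_unique)
  have nn: "0 \<le> l $ a" for a
    using pos by (intro LIMSEQ_le_const[OF comp]) (auto simp: less_imp_le)
  have "0 < l $ a" if a: "a \<in> B" for a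
  proof (rule ccontr)
    assume "\<not> 0 < l $ a"
    with nn[of a] have "l $ a = 0" by simp
    then have "filterlim (\<lambda>k. x k $ a) (at_right 0) sequentially"
      using comp[of a] pos by (simp add: filterlim_at less_imp_neq[symmetric] always_eventually)
    from filterlim_compose[OF steep this] have bot: "filterlim (\<lambda>k. \<phi> (x k $ a)) at_bot sequentially" .
    obtain b where "l $ b \<noteq> 0" using s by (metis sum.neutral zero_neq_one)
    then have b: "b \<in> B" "0 < l $ b" using l0 nn[of b] by force+
    obtain d where d: "(\<lambda>k. \<phi> (x k $ b) - \<phi> (x k $ a)) \<longlonglongrightarrow> d"
      using diff[OF b(1) a] by (auto simp: convergent_def)
    have "filterlim (\<lambda>k. (\<phi> (x k $ b) - \<phi> (x k $ a)) + \<phi> (x k $ a)) at_bot sequentially"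
      using filterlim_tendsto_add_at_top[OF tendsto_minus[OF d] bot[unfolded filterlim_uminus_at_bot]]
      by (simp add: filterlim_uminus_at_bot)
    then have "(\<lambda>k. x k $ b) \<longlonglongrightarrow> 0"
      by (intro tendsto_zero_if_potential_at_bot px) simp
    with comp[of b] b(2) show False using LIMSEQ_unique by force
  qed
  with l l0 s show thesis by (intro that)
qed

end

section \<open>Convergence of policy mirror descent\<close>

text \<open>
  Policy mirror descent seen only through the stationarity condition of its steps.
\<close>

locale pmd_run = finite_mdp P r \<gamma> + steep_potential f \<phi>
  for P :: "'s::finite \<Rightarrow> 'a::finite \<Rightarrow> 's pmf" and r \<gamma> f \<phi> +
  fixes \<eta> :: real and \<pi> :: "nat \<Rightarrow> ('s, 'a) policy"
  assumes step_size: "0 < \<eta>"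
    and iterate_pos: "\<And>k s a. 0 < pmf (\<pi> k s) a"
    and stationary: "\<And>k s a b.
      \<phi> (pmf (\<pi> (Suc k) s) a) - \<phi> (pmf (\<pi> k s) a) - \<eta> * Q_pol P r \<gamma> (\<pi> k) s a =
      \<phi> (pmf (\<pi> (Suc k) s) b) - \<phi> (pmf (\<pi> k s) b) - \<eta> * Q_pol P r \<gamma> (\<pi> k) s b"
begin

abbreviation gain :: "('s, 'a) policy \<Rightarrow> nat \<Rightarrow> 's \<Rightarrow> real" where
  "gain \<rho> k s \<equiv> (\<Sum>a\<in>UNIV. (pmf (\<rho> s) a - pmf (\<pi> k s) a) * Q (\<pi> k) s a)"

lemma breg_iterate_nonneg: "0 \<le> breg (pmf p) (pmf (\<pi> k s))"
  by (rule breg_nonneg) (auto simp: iterate_pos pmf_le_1)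

text \<open>
  The divergences from \<open>\<rho>\<close> telescope in \<open>k\<close>, and the remaining divergence has the favourable sign.
  The last term is there because the three-point identity measures the advantage of \<open>\<rho>\<close> over
  \<open>\<pi> (Suc k)\<close> instead of \<open>\<pi> k\<close>; it is controlled by \<open>gain_le_value_increase\<close>.
\<close>

lemma gain_three_point:
  "gain \<rho> k s = (breg (pmf (\<rho> s)) (pmf (\<pi> k s)) - breg (pmf (\<rho> s)) (pmf (\<pi> (Suc k) s))
      - breg (pmf (\<pi> (Suc k) s)) (pmf (\<pi> k s))) / \<eta> + gain (\<pi> (Suc k)) k s"
proof -
  have "(\<Sum>a\<in>UNIV. \<eta> * Q (\<pi> k) s a * (pmf (\<rho> s) a - pmf (\<pi> (Suc k) s) a)) =
      breg (pmf (\<rho> s)) (pmf (\<pi> k s)) - breg (pmf (\<rho> s)) (pmf (\<pi> (Suc k) s))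
      - breg (pmf (\<pi> (Suc k) s)) (pmf (\<pi> k s))"
    by (rule three_point[OF _ stationary]) (simp add: sum_pmf_UNIV)
  moreover have "(\<Sum>a\<in>UNIV. \<eta> * Q (\<pi> k) s a * (pmf (\<rho> s) a - pmf (\<pi> (Suc k) s) a)) =
      \<eta> * (gain \<rho> k s - gain (\<pi> (Suc k)) k s)"
    by (simp add: sum_distrib_left algebra_simps flip: sum_subtractf)
  ultimately show ?thesis using step_size by (simp add: field_simps)
qed

text \<open>
  The three-point identity with the old iterate as comparison point.
\<close>

lemma gain_nonneg: "0 \<le> gain (\<pi> (Suc k)) k s"
proof -
  have "breg (pmf (\<pi> k s)) (pmf (\<pi> k s)) = 0" by (simp add: breg_def)
  moreover have "gain (\<pi> k) k s = 0" by simp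
  ultimately have "gain (\<pi> (Suc k)) k s =
      (breg (pmf (\<pi> k s)) (pmf (\<pi> (Suc k) s)) + breg (pmf (\<pi> (Suc k) s)) (pmf (\<pi> k s))) / \<eta>"
    using gain_three_point[where \<rho>="\<pi> k" and k=k and s=s] by (simp only: diff_divide_distrib add_divide_distrib)
  then show ?thesis using step_size breg_iterate_nonneg by simp
qed

lemma value_mono: "V (\<pi> k) s \<le> V (\<pi> (Suc k)) s"
proof (rule policy_improvement)
  fix s
  show "(\<Sum>a\<in>UNIV. pmf (\<pi> k s) a * Q (\<pi> k) s a) \<le> (\<Sum>a\<in>UNIV. pmf (\<pi> (Suc k) s) a * Q (\<pi> k) s a)"
    using gain_nonneg[of k s] by (simp add: left_diff_distrib sum_subtractf)
qed

lemma gain_le_value_increase: "gain (\<pi> (Suc k)) k s \<le> V (\<pi> (Suc k)) s - V (\<pi> k) s"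
proof -
  have "0 \<le> avg_next (\<pi> (Suc k)) (\<lambda>s'. V (\<pi> (Suc k)) s' - V (\<pi> k) s') s"
    unfolding avg_next_def using value_mono by (intro sum_nonneg mult_nonneg_nonneg) auto
  then show ?thesis
    using bellman_diff[of "\<pi> (Suc k)" s "\<pi> k"] discount by simp
qed

text \<open>
  Summing the one-step gain of an optimal policy over \<open>k < K\<close> leaves only boundary terms, bounded
  uniformly in \<open>K\<close>. The accumulated error satisfies the Bellman recursion of that policy with these
  sums as reward, so the discounted maximum principle bounds it as well.
\<close>

lemma summable_value_error: "summable (\<lambda>k. Vstar s - V (\<pi> k) s)"
proof -
  obtain \<pi>o where o: "\<And>s. V \<pi>o s = Vstar s" using ex_optimal_policy by metis
  define D where "D k s = breg (pmf (\<pi>o s)) (pmf (\<pi> k s)) / \<eta>" for k s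
  have D: "0 \<le> D k s" for k s using breg_iterate_nonneg step_size by (simp add: D_def)
  have gain: "gain \<pi>o k s \<le> (D k s - D (Suc k) s) + (V (\<pi> (Suc k)) s - V (\<pi> k) s)" for k s
  proof -
    have "0 \<le> breg (pmf (\<pi> (Suc k) s)) (pmf (\<pi> k s)) / \<eta>"
      using breg_iterate_nonneg step_size by simp
    then show ?thesis
      using gain_three_point[where \<rho>=\<pi>o and k=k and s=s] gain_le_value_increase[of k s]
      by (simp add: D_def diff_divide_distrib)
  qed
  define C where "C = (\<Sum>s\<in>UNIV. D 0 s + (Vstar s - V (\<pi> 0) s))"
  have bound: "(\<Sum>k<K. Vstar s - V (\<pi> k) s) \<le> C / (1 - \<gamma>)" for K s
  proof (rule le_discounted_imp_le)
    fix s
    have "(\<Sum>k<K. gain \<pi>o k s) \<le> (\<Sum>k<K. (D k s - D (Suc k) s) + (V (\<pi> (Suc k)) s - V (\<pi> k) s))"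
      by (rule sum_mono) (rule gain)
    also have "\<dots> = (D 0 s - D K s) + (V (\<pi> K) s - V (\<pi> 0) s)"
      by (simp add: sum.distrib sum_lessThan_telescope[of "\<lambda>k. V (\<pi> k) s"] sum_lessThan_telescope'[of "\<lambda>k. D k s"])
    also have "\<dots> \<le> D 0 s + (Vstar s - V (\<pi> 0) s)"
      using D[of K s] V_le_opt[where \<pi>="\<pi> K" and s=s] by simp
    also have "\<dots> \<le> C"
      unfolding C_def using D V_le_opt by (intro member_le_sum) auto
    finally have "(\<Sum>k<K. gain \<pi>o k s) \<le> C" .
    moreover have "(\<Sum>k<K. Vstar s - V (\<pi> k) s) =
        (\<Sum>k<K. gain \<pi>o k s) + \<gamma> * avg_next \<pi>o (\<lambda>s. \<Sum>k<K. Vstar s - V (\<pi> k) s) s"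
      using bellman_diff[of \<pi>o s] by (simp add: o avg_next_sum sum.distrib sum_distrib_left)
    ultimately show "(\<Sum>k<K. Vstar s - V (\<pi> k) s) \<le>
        C + \<gamma> * avg_next \<pi>o (\<lambda>s. \<Sum>k<K. Vstar s - V (\<pi> k) s) s" by linarith
  qed
  show ?thesis
    by (rule bounded_imp_summable[of _ "C / (1 - \<gamma>)"])
      (use V_le_opt bound[of s "Suc _"] in \<open>auto simp: lessThan_Suc_atMost\<close>)
qed

definition err :: "nat \<Rightarrow> real" where
  "err k = sup_norm (\<lambda>s. Vstar s - V (\<pi> k) s)"

lemma value_error_le_err: "Vstar s - V (\<pi> k) s \<le> err k"
  unfolding err_def sup_norm_def by (rule order_trans[OF abs_ge_self Max_ge]) auto

lemma err_nonneg: "0 \<le> err k"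
  using value_error_le_err[where s=undefined and k=k] V_le_opt[where \<pi>="\<pi> k" and s=undefined] by linarith

lemma summable_err: "summable err"
proof (rule summable_comparison_test')
  show "summable (\<lambda>k. \<Sum>s\<in>UNIV. Vstar s - V (\<pi> k) s)"
    by (intro summable_sum summable_value_error)
  fix k
  have "err k \<le> (\<Sum>s\<in>UNIV. Vstar s - V (\<pi> k) s)"
    unfolding err_def sup_norm_def
  proof (rule Max.boundedI)
    fix x assume "x \<in> range (\<lambda>s. \<bar>Vstar s - V (\<pi> k) s\<bar>)"
    then obtain s where "x = Vstar s - V (\<pi> k) s" using V_le_opt by auto
    then show "x \<le> (\<Sum>s\<in>UNIV. Vstar s - V (\<pi> k) s)"
      using V_le_opt by (auto intro!: member_le_sum)
  qed auto
  then show "norm (err k) \<le> (\<Sum>s\<in>UNIV. Vstar s - V (\<pi> k) s)" using err_nonneg by simp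
qed

text \<open>
  In the dual coordinates \<open>\<phi>\<close> mirror descent is additive: up to a shift common to all actions,
  it sums the \<open>Q\<close>-values.
\<close>

lemma potential_diff_eq:
  "\<phi> (pmf (\<pi> k s) a) - \<phi> (pmf (\<pi> k s) b) =
    \<phi> (pmf (\<pi> 0 s) a) - \<phi> (pmf (\<pi> 0 s) b) + \<eta> * (\<Sum>j<k. Q (\<pi> j) s a - Q (\<pi> j) s b)"
proof (induction k)
  case (Suc k)
  show ?case using stationary[of k s a b] Suc by (simp add: algebra_simps)
qed simp

lemma Q_error: "Q (\<pi> k) s a \<le> Qstar s a" "Qstar s a - Q (\<pi> k) s a \<le> err k"
  using Q_error_le[of "\<pi> k" "err k"] value_error_le_err by auto

text \<open>
  Between optimal actions the differences of \<open>Q\<close>-values are within the summable value error of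
  \<open>0\<close>.
\<close>

lemma potential_diff_convergent:
  assumes "a \<in> Astar s" "b \<in> Astar s"
  shows "convergent (\<lambda>k. \<phi> (pmf (\<pi> k s) a) - \<phi> (pmf (\<pi> k s) b))"
proof -
  have "summable (\<lambda>k. Q (\<pi> k) s a - Q (\<pi> k) s b)"
  proof (rule summable_comparison_test'[OF summable_err])
    fix k
    show "norm (Q (\<pi> k) s a - Q (\<pi> k) s b) \<le> err k"
      using Q_error[where k=k and s=s and a=a] Q_error[where k=k and s=s and a=b] assms by (auto simp: opt_actions_def)
  qed
  then obtain d where "(\<lambda>k. \<Sum>j<k. Q (\<pi> j) s a - Q (\<pi> j) s b) \<longlonglongrightarrow> d"
    by (auto simp: summable_def sums_def)
  then have "(\<lambda>k. \<phi> (pmf (\<pi> 0 s) a) - \<phi> (pmf (\<pi> 0 s) b) + \<eta> * (\<Sum>j<k. Q (\<pi> j) s a - Q (\<pi> j) s b))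
      \<longlonglongrightarrow> \<phi> (pmf (\<pi> 0 s) a) - \<phi> (pmf (\<pi> 0 s) b) + \<eta> * d"
    by (intro tendsto_intros)
  then show ?thesis
    unfolding potential_diff_eq[symmetric] by (rule convergentI)
qed

text \<open>
  Against an optimal action, a nonoptimal one loses its gap at every step up to a summable error, so
  the potential difference decreases at least linearly. The potential of the optimal action stays below
  \<open>\<phi> 1\<close>, hence that of the nonoptimal one tends to \<open>-\<infinity>\<close>.
\<close>

lemma nonoptimal_prob_tendsto_0:
  assumes a: "a \<notin> Astar s"
  shows "(\<lambda>k. pmf (\<pi> k s) a) \<longlonglongrightarrow> 0"
proof -
  obtain b where b: "b \<in> Astar s" using ex_opt_action by blast
  define gap where "gap = Vstar s - Qstar s a"
  have gap: "0 < gap" using a Q_opt_le[of s a] by (auto simp: gap_def opt_actions_def)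
  define M where "M = \<phi> 1 + (\<phi> (pmf (\<pi> 0 s) a) - \<phi> (pmf (\<pi> 0 s) b)) + \<eta> * suminf err"
  have le: "\<phi> (pmf (\<pi> k s) a) \<le> M - \<eta> * gap * real k" for k
  proof -
    have "Q (\<pi> j) s a - Q (\<pi> j) s b \<le> err j - gap" for j
      using Q_error[where k=j and s=s and a=a] Q_error[where k=j and s=s and a=b] b by (simp add: gap_def opt_actions_def)
    then have "(\<Sum>j<k. Q (\<pi> j) s a - Q (\<pi> j) s b) \<le> (\<Sum>j<k. err j - gap)"
      by (rule sum_mono)
    also have "\<dots> \<le> suminf err - real k * gap"
      using sum_le_suminf[OF summable_err, of "{..<k}"] err_nonneg by (simp add: sum_subtractf)
    finally have "\<eta> * (\<Sum>j<k. Q (\<pi> j) s a - Q (\<pi> j) s b) \<le> \<eta> * (suminf err - real k * gap)"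
      using step_size by simp
    moreover have "\<phi> (pmf (\<pi> k s) b) \<le> \<phi> 1"
      by (intro \<phi>_mono iterate_pos pmf_le_1 order_refl)
    ultimately show ?thesis
      using potential_diff_eq[where k=k and s=s and a=a and b=b] by (simp add: M_def algebra_simps)
  qed
  have "filterlim (\<lambda>k. \<phi> (pmf (\<pi> k s) a)) at_bot sequentially"
    unfolding filterlim_uminus_at_bot
  proof (rule filterlim_at_top_mono)
    show "filterlim (\<lambda>k. \<eta> * gap * real k - M) at_top sequentially"
      using mult_pos_pos[OF step_size gap] by real_asymp
    show "\<forall>\<^sub>F k in sequentially. \<eta> * gap * real k - M \<le> - \<phi> (pmf (\<pi> k s) a)"
      using le by (intro always_eventually allI) (simp add: algebra_simps)
  qed
  then show ?thesis
    by (intro tendsto_zero_if_potential_at_bot) (auto simp: iterate_pos pmf_le_1)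
qed

lemma iterates_converge:
  obtains \<pi>_lim where "\<And>s. (\<lambda>k. prob_vec (\<pi> k s)) \<longlonglongrightarrow> prob_vec (\<pi>_lim s)"
    "\<And>s a. a \<notin> Astar s \<Longrightarrow> pmf (\<pi>_lim s) a = 0" "\<And>s a. a \<in> Astar s \<Longrightarrow> 0 < pmf (\<pi>_lim s) a"
proof -
  have "\<exists>p. (\<lambda>k. prob_vec (\<pi> k s)) \<longlonglongrightarrow> prob_vec p \<and>
      (\<forall>a. a \<notin> Astar s \<longrightarrow> pmf p a = 0) \<and> (\<forall>a. a \<in> Astar s \<longrightarrow> 0 < pmf p a)" for s
  proof (rule simplex_sequence_converges[of "\<lambda>k. prob_vec (\<pi> k s)" "Astar s"])
    fix l
    assume l: "(\<lambda>k. prob_vec (\<pi> k s)) \<longlonglongrightarrow> l" "\<And>a. a \<notin> Astar s \<Longrightarrow> l $ a = 0"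
      "\<And>a. a \<in> Astar s \<Longrightarrow> 0 < l $ a" "(\<Sum>a\<in>UNIV. l $ a) = 1"
    have "0 \<le> l $ a" for a using l(2,3)[of a] by (cases "a \<in> Astar s") auto
    then obtain p where p: "\<And>a. pmf p a = l $ a" using ex_pmf_of_vector[OF _ l(4)] by blast
    then have "prob_vec p = l" by (simp add: prob_vec_def vec_eq_iff)
    then show ?thesis using l p by metis
  qed (simp_all add: prob_vec_def iterate_pos sum_pmf_UNIV nonoptimal_prob_tendsto_0 potential_diff_convergent)
  then show thesis using that by metis
qed

end

theorem theorem3p8:
  fixes P :: "'s::finite \<Rightarrow> 'a::finite \<Rightarrow> 's pmf"
    and r :: "'s \<Rightarrow> 'a \<Rightarrow> real"
    and \<gamma> \<eta> :: real
    and \<psi> :: "real \<Rightarrow> ereal"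
    and \<pi> :: "nat \<Rightarrow> ('s, 'a) policy"
  assumes "\<And>s a. r s a \<in> {0..1}"
    and "0 \<le> \<gamma>" and "\<gamma> < 1"
    and "S_tilde P r \<gamma> \<noteq> {}"
    and "mirror_map \<psi>"
    and "\<eta> > 0"
    and "pmd_sequence P r \<gamma> \<psi> \<eta> \<pi>"
    and "((\<lambda>x. ereal (dpsi \<psi> x)) \<longlongrightarrow> -\<infinity>) (at_right 0)"
    and "\<exists>l<\<infinity>. ((\<lambda>x. ereal (dpsi \<psi> x)) \<longlongrightarrow> l) (at_left 1)"
  shows "summable (\<lambda>k. sup_norm (\<lambda>s. V_opt P r \<gamma> s - V_pol P r \<gamma> (\<pi> k) s)) \<and>
    (\<exists>\<pi>_lim \<in> optimal_policies P r \<gamma>.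
       (\<forall>s. (\<lambda>k. prob_vec (\<pi> k s)) \<longlonglongrightarrow> prob_vec (\<pi>_lim s)) \<and>
       (\<forall>s. \<forall>a'. a' \<notin> opt_actions P r \<gamma> s \<longrightarrow> pmf (\<pi>_lim s) a' = 0) \<and>
       (\<forall>s \<in> S_eq1 P r \<gamma>. \<forall>a \<in> opt_actions P r \<gamma> s. pmf (\<pi>_lim s) a = 1) \<and>
       (\<forall>s \<in> S_gt1 P r \<gamma>. \<forall>a \<in> opt_actions P r \<gamma> s. pmf (\<pi>_lim s) a \<in> interior (dom_fun \<psi>)))"
proof -
  note mm = \<open>mirror_map \<psi>\<close> assms(8,9)
  interpret steep_potential "fin_part \<psi>" "dpsi \<psi>" by (rule steep_potential_mirror_map[OF mm])
  note seq = \<open>pmd_sequence P r \<gamma> \<psi> \<eta> \<pi>\<close>[unfolded pmd_sequence_def]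
  \<comment> \<open>The coefficients of the linear part of the objective of the step from \<open>\<pi> k\<close>.\<close>
  define c where "c k s a = dpsi \<psi> (pmf (\<pi> k s) a) + \<eta> * Q_pol P r \<gamma> (\<pi> k) s a" for k s a
  have min: "(\<Sum>a\<in>UNIV. fin_part \<psi> (pmf (\<pi> (Suc k) s) a) - c k s a * pmf (\<pi> (Suc k) s) a) \<le>
      (\<Sum>a\<in>UNIV. fin_part \<psi> (y a) - c k s a * y a)"
    if "\<And>a. pmf (\<pi> k s) a \<in> interior (dom_fun \<psi>)" "\<And>a. 0 \<le> y a" "(\<Sum>a\<in>UNIV. y a) = 1" for k s y
    unfolding c_def using seq that by (intro pmd_step_minimizes[OF mm(1)]) auto
  have int: "pmf (\<pi> k s) a \<in> interior (dom_fun \<psi>)" for k s a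
  proof (induction k arbitrary: s a)
    case 0
    then show ?case using seq by blast
  next
    case (Suc k)
    have "0 < pmf (\<pi> (Suc k) s) a"
      by (rule minimizer_pos[of "pmf (\<pi> (Suc k) s)" "c k s"]) (auto simp: sum_pmf_UNIV intro!: min Suc)
    then show ?case by (intro half_open_unit_in_interior[OF mm(1,3)] pmf_le_1)
  qed
  interpret pmd_run P r \<gamma> "fin_part \<psi>" "dpsi \<psi>" \<eta> \<pi>
  proof
    show "0 < pmf (\<pi> k s) a" for k s a by (rule interior_dom_pos[OF mm(1,2) int])
    fix k s a b
    have "dpsi \<psi> (pmf (\<pi> (Suc k) s) a) - c k s a = dpsi \<psi> (pmf (\<pi> (Suc k) s) b) - c k s b"
      by (rule minimizer_stationary) (auto simp: sum_pmf_UNIV intro!: min int)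
    then show "dpsi \<psi> (pmf (\<pi> (Suc k) s) a) - dpsi \<psi> (pmf (\<pi> k s) a) - \<eta> * Q_pol P r \<gamma> (\<pi> k) s a =
        dpsi \<psi> (pmf (\<pi> (Suc k) s) b) - dpsi \<psi> (pmf (\<pi> k s) b) - \<eta> * Q_pol P r \<gamma> (\<pi> k) s b"
      by (simp add: c_def)
  qed (use assms in auto)
  obtain \<pi>_lim where l: "\<And>s. (\<lambda>k. prob_vec (\<pi> k s)) \<longlonglongrightarrow> prob_vec (\<pi>_lim s)"
    "\<And>s a. a \<notin> Astar s \<Longrightarrow> pmf (\<pi>_lim s) a = 0" "\<And>s a. a \<in> Astar s \<Longrightarrow> 0 < pmf (\<pi>_lim s) a"
    using iterates_converge by blast
  have one: "pmf (\<pi>_lim s) a = 1" if "s \<in> S_eq1 P r \<gamma>" "a \<in> Astar s" for s a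
  proof -
    have "Astar s = {a}" using that by (auto simp: S_eq1_def card_1_singleton_iff)
    then have "(\<Sum>b\<in>UNIV. pmf (\<pi>_lim s) b) = pmf (\<pi>_lim s) a"
      by (subst sum.mono_neutral_right[of UNIV "{a}"]) (auto simp: l(2))
    then show ?thesis by (simp add: sum_pmf_UNIV)
  qed
  show ?thesis
  proof (intro conjI bexI[of _ \<pi>_lim] allI ballI impI)
    show "summable (\<lambda>k. sup_norm (\<lambda>s. Vstar s - V (\<pi> k) s))"
      using summable_err by (simp add: err_def[abs_def])
    show "pmf (\<pi>_lim s) a \<in> interior (dom_fun \<psi>)" if "a \<in> Astar s" for s a
      by (rule half_open_unit_in_interior[OF mm(1,3) l(3)[OF that] pmf_le_1])
    show "\<pi>_lim \<in> optimal_policies P r \<gamma>"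
      by (rule supported_on_opt_actions_imp_optimal) (rule l(2))
  qed (auto simp: l one)
qed

end
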